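(* Let $\mathbb{D}$ be a division ring with finite dimension $d$ over a central subfield $\mathbb{F}$, and let $V$ be a right vector space over $\mathbb{D}$ with finite dimension $n>0$. Assume that $|\mathbb{F}| \geq dn$. Then the greatest possible dimension over $\mathbb{F}$ of a trivial spectrum $\mathbb{F}$-linear subspace of $\operatorname{End}_{\mathbb{D}}(V)$ (or, equivalently, of the matrix algebra $\mathrm{M}_n(\mathbb{D})$) is $$\alpha(n,d)=n(d-1)+d\binom{n}{2}.$$
   Context: A central subfield of $\mathbb{D}$ is a subfield contained in the center of $\mathbb{D}$. $\operatorname{End}_{\mathbb{D}}(V)$ is the $\mathbb{F}$-algebra of $\mathbb{D}$-linear endomorphisms of $V$. An $\mathbb{F}$-linear subspace $S$ of a unital $\mathbb{F}$-algebra $\mathcal{A}$ has trivial spectrum if $1_{\mathcal{A}}-x$ is a unit of $\mathcal{A}$ for all $x\in S$. *)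

theory Defs
  imports "HOL-Analysis.Analysis" "HOL-Library.Function_Algebras"
begin

(* A central subfield of 'd is given as a field 'f with a unital ring homomorphism into the
   centre of 'd; such a map is automatically injective, so the subfield is its range.
   Presenting it as a type makes vector_space available for dimensions over the subfield. *)
locale central_subfield =
  fixes emb :: "'f::field \<Rightarrow> 'd::division_ring"
  assumes emb_add: "emb (a + b) = emb a + emb b"
    and emb_mult: "emb (a * b) = emb a * emb b"
    and emb_one: "emb 1 = 1"
    and emb_central: "emb a * x = x * emb a"

(* The scalars act on the right; the locales of HOL.Modules need commutative scalars. *)
locale right_vector_space =
  fixes act :: "'v::ab_group_add \<Rightarrow> 'd::division_ring \<Rightarrow> 'v"
  assumes act_add_left: "act (v + w) a = act v a + act w a"
    and act_add_right: "act v (a + b) = act v a + act v b"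
    and act_mult: "act v (a * b) = act (act v a) b"
    and act_one: "act v 1 = v"

definition right_basis :: "('v::ab_group_add \<Rightarrow> 'd::division_ring \<Rightarrow> 'v) \<Rightarrow> 'v set \<Rightarrow> bool" where
  "right_basis act B \<longleftrightarrow> finite B \<and>
     (\<forall>c. (\<Sum>b\<in>B. act b (c b)) = 0 \<longrightarrow> (\<forall>b\<in>B. c b = 0)) \<and>
     (\<forall>v. \<exists>c. v = (\<Sum>b\<in>B. act b (c b)))"

definition right_dimension :: "('v::ab_group_add \<Rightarrow> 'd::division_ring \<Rightarrow> 'v) \<Rightarrow> nat \<Rightarrow> bool" where
  "right_dimension act n \<longleftrightarrow> (\<exists>B. right_basis act B \<and> card B = n)"

definition Endo :: "('v::ab_group_add \<Rightarrow> 'd::division_ring \<Rightarrow> 'v) \<Rightarrow> ('v \<Rightarrow> 'v) set" where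
  "Endo act = {u. (\<forall>v w. u (v + w) = u v + u w) \<and> (\<forall>v a. u (act v a) = act (u v) a)}"

definition scaleD :: "('f::field \<Rightarrow> 'd::division_ring) \<Rightarrow> 'f \<Rightarrow> 'd \<Rightarrow> 'd" where
  "scaleD emb c x = emb c * x"

definition scaleE :: "('f::field \<Rightarrow> 'd::division_ring) \<Rightarrow> ('v::ab_group_add \<Rightarrow> 'd \<Rightarrow> 'v)
    \<Rightarrow> 'f \<Rightarrow> ('v \<Rightarrow> 'v) \<Rightarrow> 'v \<Rightarrow> 'v" where
  "scaleE emb act c u = (\<lambda>v. act (u v) (emb c))"

definition scaleM :: "('f::field \<Rightarrow> 'd::division_ring) \<Rightarrow> 'f \<Rightarrow> 'd^'n^'n \<Rightarrow> 'd^'n^'n" where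
  "scaleM emb c M = (\<chi> i j. emb c * M $ i $ j)"

(* vector_space.dim is 0 for infinite-dimensional sets, hence the explicit finiteness. *)
definition fin_dim :: "('f::field \<Rightarrow> 'a::ab_group_add \<Rightarrow> 'a) \<Rightarrow> 'a set \<Rightarrow> nat \<Rightarrow> bool" where
  "fin_dim scl S m \<longleftrightarrow>
     (\<exists>B. finite B \<and> S \<subseteq> module.span scl B) \<and> vector_space.dim scl S = m"

(* In the next three definitions, a unital algebra is given by its carrier A inside a type with
   the ambient addition, its multiplication mul, its unity e and its scalar action. *)
definition unit_in :: "'a set \<Rightarrow> ('a \<Rightarrow> 'a \<Rightarrow> 'a) \<Rightarrow> 'a \<Rightarrow> 'a \<Rightarrow> bool" where
  "unit_in A mul e x \<longleftrightarrow> x \<in> A \<and> (\<exists>y\<in>A. mul x y = e \<and> mul y x = e)"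

definition trivial_spectrum_subspace :: "('f::field \<Rightarrow> 'a::ab_group_add \<Rightarrow> 'a) \<Rightarrow> 'a set
    \<Rightarrow> ('a \<Rightarrow> 'a \<Rightarrow> 'a) \<Rightarrow> 'a \<Rightarrow> 'a set \<Rightarrow> bool" where
  "trivial_spectrum_subspace scl A mul e S \<longleftrightarrow>
     S \<subseteq> A \<and> module.subspace scl S \<and> (\<forall>x\<in>S. unit_in A mul e (e - x))"

definition greatest_trivial_spectrum_dim :: "('f::field \<Rightarrow> 'a::ab_group_add \<Rightarrow> 'a) \<Rightarrow> 'a set
    \<Rightarrow> ('a \<Rightarrow> 'a \<Rightarrow> 'a) \<Rightarrow> 'a \<Rightarrow> nat \<Rightarrow> bool" where
  "greatest_trivial_spectrum_dim scl A mul e k \<longleftrightarrow>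
     (\<exists>S. trivial_spectrum_subspace scl A mul e S \<and> fin_dim scl S k) \<and>
     (\<forall>S. trivial_spectrum_subspace scl A mul e S \<longrightarrow> (\<exists>m\<le>k. fin_dim scl S m))"

definition alpha :: "nat \<Rightarrow> nat \<Rightarrow> nat" where
  "alpha n d = n * (d - 1) + d * (n choose 2)"

(* The three scalar actions are vector spaces, so span, subspace and dim have their usual
   meaning for them. *)

lemma (in central_subfield) vector_space_scaleD: "vector_space (scaleD emb)"
  by unfold_locales
    (simp_all add: scaleD_def emb_add emb_mult emb_one algebra_simps)

lemma (in central_subfield) vector_space_scaleM:
  "vector_space (scaleM emb :: 'f \<Rightarrow> 'd^'n^'n \<Rightarrow> 'd^'n^'n)"
  by unfold_locales
    (simp_all add: scaleM_def vec_eq_iff emb_add emb_mult emb_one algebra_simps)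

lemma vector_space_scaleE:
  assumes "central_subfield emb" and "right_vector_space act"
  shows "vector_space (scaleE emb act)"
proof -
  interpret central_subfield emb by fact
  interpret right_vector_space act by fact
  have comm: "emb a * emb b = emb b * emb a" for a b
    by (rule emb_central)
  show ?thesis
    by unfold_locales
      (auto simp: scaleE_def fun_eq_iff act_add_left act_add_right emb_add emb_mult emb_one
        act_one act_mult[symmetric] comm)
qed

end

theory Submission
  imports Defs
begin

text \<open>
  For the upper bound, suppose that \<open>S\<close> has trivial spectrum and that some \<open>x \<noteq> 0\<close> is adapted to
  \<open>S\<close>: no nonzero operator \<open>v \<mapsto> x \<phi>(v)\<close> with \<open>\<phi>(x) = 0\<close> belongs to \<open>S\<close>. The image of
  \<open>u \<mapsto> u x\<close> on \<open>S\<close> misses \<open>x\<close>, so it has dimension at most \<open>dn - 1\<close>, and its kernel embeds into a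
  trivial spectrum space of endomorphisms of \<open>V / x\<D>\<close>; now use induction on \<open>n\<close>. To find an adapted
  vector, consider the maps \<open>T\<^sub>x : \<phi> \<mapsto> (x \<phi> mod S, \<phi>(x))\<close> on the dual space, which depend linearly
  on \<open>x\<close>. If all of them are singular, then, since the dual has dimension \<open>dn \<le> |F|\<close>, there are \<open>x\<close>
  and \<open>\<phi> \<noteq> 0\<close> such that \<open>T\<^sub>x \<phi> = 0\<close> and \<open>T\<^sub>y \<phi>\<close> lies in the image of \<open>T\<^sub>x\<close> for all \<open>y\<close>. Choosing \<open>y\<close>
  with \<open>\<phi>(y) = 1\<close> gives \<open>u = y \<phi> - x \<psi>\<close> in \<open>S\<close> with \<open>\<phi> \<circ> (1 - u) = 0\<close>, a contradiction.

  The bound is attained by the upper triangular matrices whose diagonal entries lie in a fixed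
  \<open>F\<close>-hyperplane of \<open>\<D>\<close> that does not contain 1.
\<close>

subsection \<open>Dimension bounds and singular pencils\<close>

text \<open>Unlike a bound on \<open>dim\<close>, which is 0 for infinite-dimensional sets, this
  bound includes finite dimension. The spanning set may lie outside \<open>S\<close>.\<close>

definition spanned_by_at_most :: "('f::field \<Rightarrow> 'a::ab_group_add \<Rightarrow> 'a) \<Rightarrow> 'a set \<Rightarrow> nat \<Rightarrow> bool" where
  "spanned_by_at_most scl S k \<longleftrightarrow> (\<exists>B. finite B \<and> card B \<le> k \<and> S \<subseteq> module.span scl B)"

context vector_space
begin

lemma spanned_by_at_most_imp_fin_dim:
  assumes "spanned_by_at_most scale S k"
  shows "\<exists>m\<le>k. fin_dim scale S m"
proof -
  obtain B where "finite B" "card B \<le> k" "S \<subseteq> span B"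
    using assms unfolding spanned_by_at_most_def by blast
  moreover from this have "dim S \<le> k"
    using dim_le_card[of S B] by linarith
  ultimately show ?thesis
    unfolding fin_dim_def by blast
qed

text \<open>Injectivity lets the size of the index set count independent vectors. It holds because
  two equal members would satisfy the relation with coefficients 1 and -1.\<close>

lemma independent_family:
  assumes "finite A"
    and zero: "\<And>c. (\<Sum>a\<in>A. scale (c a) (f a)) = 0 \<Longrightarrow> \<forall>a\<in>A. c a = 0"
  shows "inj_on f A \<and> independent (f ` A)"
proof
  show inj: "inj_on f A"
  proof (rule inj_onI, rule ccontr)
    fix a b assume ab: "a \<in> A" "b \<in> A" "f a = f b" "a \<noteq> b"
    define c where "c = (\<lambda>x. if x = a then 1 else if x = b then - 1 else (0::'a))"
    have "(\<Sum>x\<in>A. scale (c x) (f x)) = (\<Sum>x\<in>{a, b}. scale (c x) (f x))"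
      using ab assms(1) by (intro sum.mono_neutral_right) (auto simp: c_def)
    also have "\<dots> = 0"
      using ab by (simp add: c_def)
    finally have "c a = 0"
      using zero ab(1) by blast
    then show False
      by (simp add: c_def)
  qed
  show "independent (f ` A)"
  proof (rule independent_if_scalars_zero)
    show "finite (f ` A)"
      using assms(1) by simp
    fix g x assume "(\<Sum>x\<in>f ` A. scale (g x) x) = 0" "x \<in> f ` A"
    then show "g x = 0"
      using zero[of "g \<circ> f"] by (auto simp: sum.reindex[OF inj])
  qed
qed

text \<open>Adjoining \<open>x\<close> to a basis of \<open>U\<close> keeps it independent inside
  \<open>V\<close>, which costs one of the \<open>k\<close> available elements.\<close>

lemma proper_subspace_spanned:
  assumes "spanned_by_at_most scale V k" "subspace V" "subspace U" "U \<subseteq> V" "x \<in> V" "x \<notin> U"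
  shows "spanned_by_at_most scale U (k - 1)"
proof -
  obtain C where C: "finite C" "card C \<le> k" "V \<subseteq> span C"
    using assms(1) unfolding spanned_by_at_most_def by blast
  obtain B where B: "B \<subseteq> U" "independent B" "U \<subseteq> span B"
    using maximal_independent_subset by blast
  have "span B = U"
    using B assms(3) span_minimal by blast
  then have "independent (insert x B)" "x \<notin> B"
    using B assms(6) independent_insertI span_base by auto
  moreover have "insert x B \<subseteq> span C"
    using B(1) C(3) assms by blast
  ultimately have "finite (insert x B) \<and> card (insert x B) \<le> card C"
    by (intro independent_span_bound C(1))
  then have "finite B \<and> card B \<le> k - 1"
    using \<open>x \<notin> B\<close> C(2) by auto
  then show ?thesis
    using B(3) unfolding spanned_by_at_most_def by blast
qed

lemma fin_dim_card:
  assumes "independent B" "finite B"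
  shows "fin_dim scale (span B) (card B)"
  using assms dim_span_eq_card_independent unfolding fin_dim_def by blast

end

context vector_space_pair
begin

text \<open>Preimages in \<open>S\<close> of a basis of the image, together with a spanning set of
  the kernel, span \<open>S\<close>.\<close>

lemma rank_nullity_bound:
  assumes lin: "Vector_Spaces.linear s1 s2 f"
    and S: "vs1.subspace S"
    and img: "spanned_by_at_most s2 (f ` S) k"
    and ker: "spanned_by_at_most s1 {u \<in> S. f u = 0} l"
  shows "spanned_by_at_most s1 S (k + l)"
proof -
  interpret f: Vector_Spaces.linear s1 s2 f by fact
  obtain C0 where C0: "finite C0" "card C0 \<le> k" "f ` S \<subseteq> vs2.span C0"
    using img unfolding spanned_by_at_most_def by blast
  \<comment> \<open>\<open>C0\<close> may leave the image; a basis inside the image can be lifted to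
    \<open>S\<close>.\<close>
  obtain C where C: "C \<subseteq> f ` S" "vs2.independent C" "f ` S \<subseteq> vs2.span C"
    using vs2.maximal_independent_subset by blast
  have Cfin: "finite C" "card C \<le> k"
    using vs2.independent_span_bound[OF C0(1) C(2)] subset_trans[OF C(1) C0(3)] C0(2)
    by (auto intro: le_trans)
  obtain g where g: "\<And>c. c \<in> C \<Longrightarrow> g c \<in> S \<and> f (g c) = c"
  proof -
    have "\<forall>c\<in>C. \<exists>u. u \<in> S \<and> f u = c"
      using C(1) by auto
    then show ?thesis
      using that bchoice by metis
  qed
  obtain B where B: "finite B" "card B \<le> l" "{u \<in> S. f u = 0} \<subseteq> vs1.span B"
    using ker unfolding spanned_by_at_most_def by blast
  let ?D = "g ` C \<union> B"
  have "u \<in> vs1.span ?D" if "u \<in> S" for u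
  proof -
    have "f u \<in> range (\<lambda>a. \<Sum>c\<in>C. s2 (a c) c)"
      using C(3) that vs2.span_finite[OF Cfin(1)] by blast
    then obtain a where a: "f u = (\<Sum>c\<in>C. s2 (a c) c)"
      by blast
    define w where "w = (\<Sum>c\<in>C. s1 (a c) (g c))"
    have "f w = f u"
      unfolding w_def a f.sum f.scale by (rule sum.cong) (auto simp: g)
    moreover have "w \<in> S"
      unfolding w_def using S g by (auto intro!: vs1.subspace_sum vs1.subspace_scale)
    ultimately have "u - w \<in> vs1.span B"
      using B(3) that S by (auto simp: f.diff vs1.subspace_diff)
    then have "u - w \<in> vs1.span ?D"
      using vs1.span_mono[of B ?D] by auto
    moreover have "w \<in> vs1.span ?D"
      unfolding w_def by (intro vs1.span_sum vs1.span_scale vs1.span_base) auto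
    ultimately show ?thesis
      using vs1.span_add by fastforce
  qed
  moreover have "card ?D \<le> k + l"
    using card_Un_le[of "g ` C" B] card_image_le[OF Cfin(1), of g] Cfin(2) B(2) by linarith
  ultimately show ?thesis
    unfolding spanned_by_at_most_def using B(1) Cfin(1) by (intro exI[of _ ?D]) auto
qed

lemma injective_bound:
  assumes "Vector_Spaces.linear s1 s2 f" "vs1.subspace S"
    and "spanned_by_at_most s2 (f ` S) k"
    and "\<And>u. u \<in> S \<Longrightarrow> f u = 0 \<Longrightarrow> u = 0"
  shows "spanned_by_at_most s1 S k"
proof -
  have "spanned_by_at_most s1 {u \<in> S. f u = 0} 0"
    unfolding spanned_by_at_most_def using assms(4) by (intro exI[of _ "{}"]) auto
  from rank_nullity_bound[OF assms(1-3) this] show ?thesis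
    by simp
qed

lemma fin_dim_injective_image:
  assumes lin: "Vector_Spaces.linear s1 s2 f" and inj: "inj f"
  shows "fin_dim s2 (f ` S) m \<longleftrightarrow> fin_dim s1 S m"
proof -
  interpret f: Vector_Spaces.linear s1 s2 f by fact
  obtain B where B: "B \<subseteq> S" "vs1.independent B" "S \<subseteq> vs1.span B" "card B = vs1.dim S"
    using vs1.basis_exists by blast
  have fB: "vs2.independent (f ` B)" "f ` S \<subseteq> vs2.span (f ` B)" "f ` B \<subseteq> f ` S"
    using f.independent_inj_image[OF B(2) inj] f.spans_image[OF B(3)] B(1) by auto
  have dim: "vs2.dim (f ` S) = vs1.dim S"
    using vs2.basis_card_eq_dim[OF fB(3,2,1)] B(4) card_image[OF inj_on_subset[OF inj subset_UNIV, of B]]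
    by simp
  have "finite B" if "finite C" "f ` S \<subseteq> vs2.span C" for C
  proof -
    have "finite (f ` B)"
      using vs2.independent_span_bound[OF that(1) fB(1)] fB(3) that(2) by auto
    then show ?thesis
      using inj by (meson finite_imageD inj_on_subset subset_UNIV)
  qed
  moreover have "finite (f ` C) \<and> f ` S \<subseteq> vs2.span (f ` C)" if "finite C" "S \<subseteq> vs1.span C" for C
    using that f.spans_image by auto
  ultimately have "(\<exists>C. finite C \<and> f ` S \<subseteq> vs2.span C) \<longleftrightarrow> (\<exists>C. finite C \<and> S \<subseteq> vs1.span C)"
    using B(3) by metis
  then show ?thesis
    unfolding fin_dim_def dim by simp
qed

end

text \<open>Vectors in the kernels of distinct members \<open>A + t B\<close> of a pencil are independent, as for
  eigenvectors; that \<open>A\<close> itself is singular is compensated by \<open>B \<phi> \<notin> A ` W\<close>.\<close>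

locale singular_pencil = vector_space_pair s1 s2
  for s1 :: "'a::field \<Rightarrow> 'b::ab_group_add \<Rightarrow> 'b"
    and s2 :: "'a \<Rightarrow> 'c::ab_group_add \<Rightarrow> 'c" +
  fixes A B :: "'b \<Rightarrow> 'c" and W :: "'b set" and \<phi> :: 'b and v :: "'a \<Rightarrow> 'b"
  assumes linA: "Vector_Spaces.linear s1 s2 A" and linB: "Vector_Spaces.linear s1 s2 B"
    and W: "vs1.subspace W"
    and phi: "\<phi> \<in> W" "\<phi> \<noteq> 0" "A \<phi> = 0"
    and kerA: "\<And>w. w \<in> W \<Longrightarrow> A w = 0 \<Longrightarrow> \<exists>a. w = s1 a \<phi>"
    and notin: "B \<phi> \<notin> A ` W"
    and v: "\<And>t. t \<noteq> 0 \<Longrightarrow> v t \<in> W \<and> v t \<noteq> 0 \<and> A (v t) + s2 t (B (v t)) = 0"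
begin

interpretation A: Vector_Spaces.linear s1 s2 A by (rule linA)
interpretation B: Vector_Spaces.linear s1 s2 B by (rule linB)

text \<open>Applying \<open>B\<close> turns the relation into \<open>a B \<phi> = A z\<close>,
  because \<open>B (v t) = - A (v t) / t\<close>. Hence \<open>a = 0\<close> by
  \<open>notin\<close>, and \<open>z\<close> lies in the kernel line of \<open>A\<close>. The vector
  \<open>w\<close> makes room for the kernel of \<open>B\<close>.\<close>

lemma relation_step:
  assumes T: "finite T" "0 \<notin> T" and w: "B w = 0"
    and rel: "(\<Sum>t\<in>T. s1 (c t) (v t)) + s1 a \<phi> + w = 0"
  shows "a = 0 \<and> (\<exists>a'. (\<Sum>t\<in>T. s1 (c t / t) (v t)) + s1 a' \<phi> = 0)"
proof -
  define z where "z = (\<Sum>t\<in>T. s1 (c t / t) (v t))"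
  have zW: "z \<in> W"
    unfolding z_def using T(2) v by (intro vs1.subspace_sum vs1.subspace_scale W) metis
  have Bv: "B (s1 (c t) (v t)) = - A (s1 (c t / t) (v t))" if "t \<in> T" for t
  proof -
    have t: "t \<noteq> 0"
      using that T(2) by auto
    have "A (v t) = - s2 t (B (v t))"
      using v[OF t] by (simp add: eq_neg_iff_add_eq_0)
    then show ?thesis
      using t by (simp add: A.scale B.scale)
  qed
  have "B ((\<Sum>t\<in>T. s1 (c t) (v t)) + s1 a \<phi> + w) = 0"
    using rel by simp
  moreover have "B (\<Sum>t\<in>T. s1 (c t) (v t)) = - A z"
    unfolding z_def B.sum A.sum sum_negf[symmetric] by (rule sum.cong) (auto simp: Bv)
  ultimately have Az: "s2 a (B \<phi>) = A z"
    by (simp add: B.add B.scale w)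
  have a: "a = 0"
  proof (rule ccontr)
    assume "a \<noteq> 0"
    then have "B \<phi> = s2 (inverse a) (s2 a (B \<phi>))"
      by simp
    also have "\<dots> = A (s1 (inverse a) z)"
      by (simp only: Az A.scale)
    finally show False
      using notin W zW vs1.subspace_scale by blast
  qed
  then obtain b where "z = s1 b \<phi>"
    using kerA[OF zW] Az by auto
  then have "z + s1 (- b) \<phi> = 0"
    by simp
  with a show ?thesis
    unfolding z_def by blast
qed

text \<open>As for eigenvectors, subtracting \<open>1 / s\<close> times the relation from its
  divided form eliminates \<open>v s\<close> and leaves the factors
  \<open>1 / t - 1 / s\<close>.\<close>

lemma relation_trivial:
  assumes "finite T" "0 \<notin> T" "(\<Sum>t\<in>T. s1 (c t) (v t)) + s1 a \<phi> = 0"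
  shows "\<forall>t\<in>T. c t = 0"
  using assms
proof (induction T arbitrary: c a rule: finite_induct)
  case empty
  then show ?case by simp
next
  case (insert s T)
  have s: "s \<noteq> 0"
    using insert.prems by auto
  have fin: "finite (insert s T)"
    using insert by simp
  obtain a' where a: "a = 0"
    and a': "(\<Sum>t\<in>insert s T. s1 (c t / t) (v t)) + s1 a' \<phi> = 0"
    using relation_step[OF fin insert.prems(1), of 0 c a] insert.prems(2) by auto
  \<comment> \<open>A second division step shows that the divided relation has no
    \<open>\<phi>\<close> term either.\<close>
  have a'0: "a' = 0"
    using relation_step[OF fin insert.prems(1), of 0 "\<lambda>t. c t / t" a'] a' by auto
  have "(\<Sum>t\<in>T. s1 (c t / t - c t / s) (v t)) =
      (\<Sum>t\<in>insert s T. s1 (c t / t) (v t)) - s1 (1 / s) (\<Sum>t\<in>insert s T. s1 (c t) (v t))"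
    using insert.hyps
    by (simp add: vs1.scale_left_diff_distrib vs1.scale_right_distrib sum_subtractf vs1.scale_sum_right)
  then have "(\<Sum>t\<in>T. s1 (c t / t - c t / s) (v t)) + s1 0 \<phi> = 0"
    using a a' a'0 insert.prems(2) by simp
  then have cst: "\<forall>t\<in>T. c t / t - c t / s = 0"
    using insert.IH[of "\<lambda>t. c t / t - c t / s" 0] insert.prems(1) by simp
  have cT: "\<forall>t\<in>T. c t = 0"
  proof
    fix t assume t: "t \<in> T"
    then have "t \<noteq> 0" "t \<noteq> s"
      using insert.prems(1) insert.hyps(2) by auto
    then show "c t = 0"
      using cst t s by auto
  qed
  then have "s1 (c s) (v s) = 0"
    using insert.prems(2) insert.hyps a by simp
  then show ?case
    using cT v[OF s] by auto
qed

text \<open>The vector \<open>u\<close> belongs to the point at infinity of the pencil, where the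
  operator is \<open>B\<close>; one use of \<open>relation_step\<close> removes it.\<close>

lemma independent_kernels:
  assumes T: "finite T" "0 \<notin> T" and u: "u \<noteq> 0" "B u = 0"
    and rel: "(\<Sum>t\<in>T. s1 (c t) (v t)) + s1 a \<phi> + s1 b u = 0"
  shows "(\<forall>t\<in>T. c t = 0) \<and> a = 0 \<and> b = 0"
proof -
  have "B (s1 b u) = 0"
    by (simp add: B.scale u)
  from relation_step[OF T this rel] obtain a' where a: "a = 0"
    and "(\<Sum>t\<in>T. s1 (c t / t) (v t)) + s1 a' \<phi> = 0"
    by blast
  then have "\<forall>t\<in>T. c t / t = 0"
    using relation_trivial[OF T, of "\<lambda>t. c t / t" a'] by blast
  then have "\<forall>t\<in>T. c t = 0"
    using T(2) by auto
  with a rel u(1) show ?thesis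
    by auto
qed

end

context vector_space_pair
begin

text \<open>For a minimal \<open>E\<close> whose span meets every kernel, some \<open>T x\<close> has a one-dimensional kernel on
  that span. If its image misses \<open>T y \<phi>\<close>, then the kernel vectors of the pencil spanned by \<open>T x\<close>
  and \<open>T y\<close> are more than \<open>card E\<close> independent vectors, one for each point of the projective line.\<close>

lemma singular_family_kernel:
  fixes T :: "'x \<Rightarrow> 'b \<Rightarrow> 'c"
  assumes lin: "\<And>x. Vector_Spaces.linear s1 s2 (T x)"
    and E0: "finite E0" "infinite (UNIV :: 'a set) \<or> card E0 \<le> CARD('a)"
    and pencil: "\<And>x y t. \<exists>z. \<forall>\<phi>\<in>vs1.span E0. T z \<phi> = T x \<phi> + s2 t (T y \<phi>)"
    and sing: "\<And>x. \<exists>\<phi>\<in>vs1.span E0. \<phi> \<noteq> 0 \<and> T x \<phi> = 0"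
  shows "\<exists>x. \<exists>\<phi>\<in>vs1.span E0. \<phi> \<noteq> 0 \<and> T x \<phi> = 0 \<and> (\<forall>y. \<exists>\<psi>\<in>vs1.span E0. T y \<phi> = T x \<psi>)"
proof -
  define P where "P E \<longleftrightarrow> E \<subseteq> E0 \<and> (\<forall>x. \<exists>\<phi>\<in>vs1.span E. \<phi> \<noteq> 0 \<and> T x \<phi> = 0)" for E
  have "P E0"
    using sing by (simp add: P_def)
  from ex_has_least_nat[of P E0 card, OF this] obtain E
    where E: "P E" and least: "\<And>E'. P E' \<Longrightarrow> card E \<le> card E'"
    by blast
  have sub: "vs1.span E \<subseteq> vs1.span E0"
    using E vs1.span_mono unfolding P_def by blast
  have finE: "finite E"
    using E E0(1) finite_subset unfolding P_def by blast
  have "E \<noteq> {}"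
    using E unfolding P_def by auto
  then obtain e where e: "e \<in> E"
    by blast
  have "\<not> P (E - {e})"
    using least[of "E - {e}"] card_Diff1_less[OF finE e] by linarith
  then obtain x where x: "\<And>\<phi>. \<phi> \<in> vs1.span (E - {e}) \<Longrightarrow> T x \<phi> = 0 \<Longrightarrow> \<phi> = 0"
    using E unfolding P_def by blast
  obtain \<phi> where phi: "\<phi> \<in> vs1.span E" "\<phi> \<noteq> 0" "T x \<phi> = 0"
    using E unfolding P_def by blast
  interpret Tx: Vector_Spaces.linear s1 s2 "T x" by (rule lin)
  \<comment> \<open>The coefficient \<open>k\<close> of \<open>e\<close> in \<open>\<phi>\<close> is
    nonzero, so subtracting a multiple of \<open>\<phi>\<close> moves any kernel vector into the
    smaller span, where \<open>T x\<close> is injective.\<close>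
  obtain k where k: "\<phi> - s1 k e \<in> vs1.span (E - {e})"
    using vs1.span_breakdown[OF e phi(1)] by blast
  have k0: "k \<noteq> 0"
    using x[of \<phi>] k phi by auto
  have ker: "\<exists>a. w = s1 a \<phi>" if w: "w \<in> vs1.span E" "T x w = 0" for w
  proof -
    obtain l where l: "w - s1 l e \<in> vs1.span (E - {e})"
      using vs1.span_breakdown[OF e w(1)] by blast
    have "w - s1 (l / k) \<phi> = (w - s1 l e) - s1 (l / k) (\<phi> - s1 k e)"
      using k0 by (simp add: vs1.scale_right_diff_distrib)
    then have "w - s1 (l / k) \<phi> \<in> vs1.span (E - {e})"
      using k l by (simp only: vs1.span_diff vs1.span_scale)
    moreover have "T x (w - s1 (l / k) \<phi>) = 0"
      by (simp add: Tx.diff Tx.scale w phi)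
    ultimately have "w - s1 (l / k) \<phi> = 0"
      by (rule x)
    then show ?thesis
      by auto
  qed
  have "\<exists>\<psi>\<in>vs1.span E. T y \<phi> = T x \<psi>" for y
  proof (rule ccontr)
    assume neg: "\<not> (\<exists>\<psi>\<in>vs1.span E. T y \<phi> = T x \<psi>)"
    \<comment> \<open>\<open>T x + t T y\<close> agrees on the span with a member of the family,
      hence is singular there.\<close>
    have "\<exists>v. v \<in> vs1.span E \<and> v \<noteq> 0 \<and> T x v + s2 t (T y v) = 0" for t
      using pencil[of x t y] E sub unfolding P_def by (metis subsetD)
    then obtain v where v: "\<And>t. v t \<in> vs1.span E \<and> v t \<noteq> 0 \<and> T x (v t) + s2 t (T y (v t)) = 0"
      by metis
    obtain u where u: "u \<in> vs1.span E" "u \<noteq> 0" "T y u = 0"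
      using E unfolding P_def by blast
    interpret singular_pencil s1 s2 "T x" "T y" "vs1.span E" \<phi> v
      by (intro singular_pencil.intro singular_pencil_axioms.intro vector_space_pair_axioms lin
          vs1.subspace_span phi) (use ker neg v in blast)+
    \<comment> \<open>The 2 counts the vectors for 0 and infinity. Over a finite field all nonzero
      scalars are used, and the total exceeds the order of the field by one.\<close>
    obtain N :: "'a set" where N: "finite N" "0 \<notin> N" "card E < card N + 2"
    proof (cases "finite (UNIV :: 'a set)")
      case True
      then have "card (UNIV - {0 :: 'a}) + 1 = CARD('a)"
        by (metis Suc_eq_plus1 UNIV_I card_Suc_Diff1)
      moreover have "card E \<le> card E0"
        using E E0(1) card_mono unfolding P_def by blast
      ultimately show ?thesis
        using that[of "UNIV - {0}"] True E0(2) by auto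
    next
      case False
      then have "infinite (UNIV - {0 :: 'a})"
        by simp
      from infinite_arbitrarily_large[OF this, of "card E"] obtain N
        where "N \<subseteq> UNIV - {0 :: 'a}" "finite N" "card N = card E"
        by blast
      then show ?thesis
        using that[of N] by auto
    qed
    \<comment> \<open>\<open>None\<close> is the point at infinity with kernel vector
      \<open>u\<close>, and \<open>Some 0\<close> carries \<open>\<phi>\<close>.\<close>
    define I where "I = insert None (insert (Some 0) (Some ` N))"
    define f where "f i = (case i of None \<Rightarrow> u | Some t \<Rightarrow> if t = 0 then \<phi> else v t)" for i
    have cardI: "card I = card N + 2"
      using N unfolding I_def by (auto simp: card_image image_iff)
    have sumI: "(\<Sum>i\<in>I. s1 (c i) (f i)) =
        (\<Sum>t\<in>N. s1 (c (Some t)) (v t)) + s1 (c (Some 0)) \<phi> + s1 (c None) u" for c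
    proof -
      have "(\<Sum>i\<in>Some ` N. s1 (c i) (f i)) = (\<Sum>t\<in>N. s1 (c (Some t)) (v t))"
        unfolding f_def using N by (auto simp: sum.reindex intro!: sum.cong)
      then show ?thesis
        unfolding I_def using N by (simp add: f_def image_iff)
    qed
    have "inj_on f I \<and> vs1.independent (f ` I)"
    proof (rule vs1.independent_family)
      show "finite I"
        using N unfolding I_def by simp
      fix c assume "(\<Sum>i\<in>I. s1 (c i) (f i)) = 0"
      from independent_kernels[OF N(1,2) u(2,3) this[unfolded sumI]]
      show "\<forall>i\<in>I. c i = 0"
        by (auto simp: I_def)
    qed
    moreover have "f ` I \<subseteq> vs1.span E"
      using u phi v by (auto simp: I_def f_def)
    ultimately have "card I \<le> card E"
      using vs1.independent_span_bound[OF finE, of "f ` I"] by (simp add: card_image)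
    then show False
      using cardI N(3) by simp
  qed
  then show ?thesis
    using phi sub by blast
qed

end

subsection \<open>The upper bound\<close>

definition scaleV :: "('f::field \<Rightarrow> 'd::division_ring) \<Rightarrow> ('v::ab_group_add \<Rightarrow> 'd \<Rightarrow> 'v) \<Rightarrow> 'f \<Rightarrow> 'v \<Rightarrow> 'v" where
  "scaleV emb act c v = act v (emb c)"

definition scaleF :: "('f::field \<Rightarrow> 'd::division_ring) \<Rightarrow> 'f \<Rightarrow> ('v \<Rightarrow> 'd) \<Rightarrow> 'v \<Rightarrow> 'd" where
  "scaleF emb c \<phi> = (\<lambda>v. emb c * \<phi> v)"

definition rank_one :: "('v::ab_group_add \<Rightarrow> 'd::division_ring \<Rightarrow> 'v) \<Rightarrow> 'v \<Rightarrow> ('v \<Rightarrow> 'd) \<Rightarrow> 'v \<Rightarrow> 'v" where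
  "rank_one act x \<phi> = (\<lambda>v. act x (\<phi> v))"

lemma sum_apply:
  fixes f :: "'i \<Rightarrow> 'a \<Rightarrow> 'b::comm_monoid_add"
  shows "(\<Sum>i\<in>I. f i) x = (\<Sum>i\<in>I. f i x)"
  by (induction I rule: infinite_finite_induct) simp_all

text \<open>\<open>D\<close> is a basis of the division ring over the subfield; as it contains 1, the remaining
  elements span a hyperplane without 1.\<close>

locale division_algebra_space =
  central_subfield emb + right_vector_space act
  for emb :: "'f::field \<Rightarrow> 'd::division_ring" and act :: "'v::ab_group_add \<Rightarrow> 'd \<Rightarrow> 'v" +
  fixes D :: "'d set"
  assumes finite_D: "finite D"
    and independent_D: "\<not> module.dependent (scaleD emb) D"
    and span_D: "module.span (scaleD emb) D = UNIV"
    and one_D: "1 \<in> D"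
begin

lemma act_zero_left [simp]: "act 0 a = 0"
  using act_add_left[of 0 0 a] by simp

lemma act_zero_right [simp]: "act v 0 = 0"
  using act_add_right[of v 0 0] by simp

lemma act_minus_left: "act (- v) a = - act v a"
  using act_add_left[of v "- v" a] by (simp add: eq_neg_iff_add_eq_0 add.commute)

lemma act_minus_right: "act v (- a) = - act v a"
  using act_add_right[of v a "- a"] by (simp add: eq_neg_iff_add_eq_0 add.commute)

lemma act_diff_left: "act (v - w) a = act v a - act w a"
  using act_add_left[of v "- w" a] by (simp add: act_minus_left)

lemma act_diff_right: "act v (a - b) = act v a - act v b"
  using act_add_right[of v a "- b"] by (simp add: act_minus_right)

lemma act_sum_left: "act (\<Sum>i\<in>I. f i) a = (\<Sum>i\<in>I. act (f i) a)"
  by (induction I rule: infinite_finite_induct) (simp_all add: act_add_left)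

lemma act_emb_mult: "act x (emb c * a) = act (act x a) (emb c)"
  by (simp add: emb_central act_mult)

sublocale D: vector_space "scaleD emb"
  by (rule vector_space_scaleD)

sublocale V: vector_space "scaleV emb act"
proof
  fix a b :: 'f and v :: 'v
  show "scaleV emb act a (scaleV emb act b v) = scaleV emb act (a * b) v"
    unfolding scaleV_def emb_mult by (simp only: act_emb_mult)
qed (simp_all add: scaleV_def act_add_left act_add_right emb_add emb_one act_one)

sublocale E: vector_space "scaleE emb act"
  by (rule vector_space_scaleE) unfold_locales

sublocale F: vector_space "scaleF emb :: 'f \<Rightarrow> ('v \<Rightarrow> 'd) \<Rightarrow> 'v \<Rightarrow> 'd"
  by unfold_locales
    (simp_all add: scaleF_def fun_eq_iff emb_add emb_mult emb_one algebra_simps)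

sublocale EV: vector_space_pair "scaleE emb act" "scaleV emb act" ..
sublocale EE: vector_space_pair "scaleE emb act" "scaleE emb act" ..
sublocale ED: vector_space_prod "scaleE emb act" "scaleD emb" ..
sublocale FP: vector_space_pair "scaleF emb :: 'f \<Rightarrow> ('v \<Rightarrow> 'd) \<Rightarrow> 'v \<Rightarrow> 'd" ED.scale ..

definition dual :: "('v \<Rightarrow> 'd) set" where
  "dual = {\<phi>. (\<forall>v w. \<phi> (v + w) = \<phi> v + \<phi> w) \<and> (\<forall>v a. \<phi> (act v a) = \<phi> v * a)}"

lemma dual_add: "\<phi> \<in> dual \<Longrightarrow> \<phi> (v + w) = \<phi> v + \<phi> w"
  and dual_act: "\<phi> \<in> dual \<Longrightarrow> \<phi> (act v a) = \<phi> v * a"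
  by (simp_all add: dual_def)

lemma dual_zero: "\<phi> \<in> dual \<Longrightarrow> \<phi> 0 = 0"
  using dual_add[of \<phi> 0 0] by simp

lemma dual_diff: "\<phi> \<in> dual \<Longrightarrow> \<phi> (v - w) = \<phi> v - \<phi> w"
  using dual_add[of \<phi> "v - w" w] by simp

lemma dual_sum: "\<phi> \<in> dual \<Longrightarrow> \<phi> (\<Sum>i\<in>I. f i) = (\<Sum>i\<in>I. \<phi> (f i))"
  by (induction I rule: infinite_finite_induct) (simp_all add: dual_add dual_zero)

lemma Endo_add: "u \<in> Endo act \<Longrightarrow> u (v + w) = u v + u w"
  and Endo_act: "u \<in> Endo act \<Longrightarrow> u (act v a) = act (u v) a"
  by (simp_all add: Endo_def)

lemma Endo_zero: "u \<in> Endo act \<Longrightarrow> u 0 = 0"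
  using Endo_add[of u 0 0] by simp

lemma Endo_diff: "u \<in> Endo act \<Longrightarrow> u (v - w) = u v - u w"
  using Endo_add[of u "v - w" w] by simp

lemma Endo_sum: "u \<in> Endo act \<Longrightarrow> u (\<Sum>i\<in>I. f i) = (\<Sum>i\<in>I. u (f i))"
  by (induction I rule: infinite_finite_induct) (simp_all add: Endo_add Endo_zero)

lemma rank_one_Endo: "\<phi> \<in> dual \<Longrightarrow> rank_one act x \<phi> \<in> Endo act"
  by (simp add: Endo_def rank_one_def dual_add dual_act act_add_right act_mult)

text \<open>\<open>proj I b \<theta>\<close> is the idempotent onto the span of \<open>b\<close> along the common kernel of \<open>\<theta>\<close>, and
  \<open>proj_dual I b \<theta>\<close> is the dual of its range.\<close>

definition dual_system :: "'i set \<Rightarrow> ('i \<Rightarrow> 'v) \<Rightarrow> ('i \<Rightarrow> 'v \<Rightarrow> 'd) \<Rightarrow> bool" where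
  "dual_system I b \<theta> \<longleftrightarrow> finite I \<and> (\<forall>i\<in>I. \<theta> i \<in> dual) \<and>
     (\<forall>i\<in>I. \<forall>j\<in>I. \<theta> i (b j) = (if i = j then 1 else 0))"

definition proj :: "'i set \<Rightarrow> ('i \<Rightarrow> 'v) \<Rightarrow> ('i \<Rightarrow> 'v \<Rightarrow> 'd) \<Rightarrow> 'v \<Rightarrow> 'v" where
  "proj I b \<theta> v = (\<Sum>i\<in>I. act (b i) (\<theta> i v))"

definition proj_dual :: "'i set \<Rightarrow> ('i \<Rightarrow> 'v) \<Rightarrow> ('i \<Rightarrow> 'v \<Rightarrow> 'd) \<Rightarrow> ('v \<Rightarrow> 'd) set" where
  "proj_dual I b \<theta> = {\<phi> \<in> dual. \<forall>v. \<phi> (proj I b \<theta> v) = \<phi> v}"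

context
  fixes I :: "'i set" and b \<theta>
  assumes sys: "dual_system I b \<theta>"
begin

lemma finite_I: "finite I"
  and coord_dual: "i \<in> I \<Longrightarrow> \<theta> i \<in> dual"
  and coord_basis: "i \<in> I \<Longrightarrow> j \<in> I \<Longrightarrow> \<theta> i (b j) = (if i = j then 1 else 0)"
  using sys by (simp_all add: dual_system_def)

lemma coord_combination:
  assumes "i \<in> I"
  shows "\<theta> i (\<Sum>j\<in>I. act (b j) (c j)) = c i"
proof -
  have "\<theta> i (\<Sum>j\<in>I. act (b j) (c j)) = (\<Sum>j\<in>I. if i = j then c j else 0)"
    unfolding dual_sum[OF coord_dual[OF assms]]
    by (rule sum.cong) (simp_all add: dual_act coord_dual coord_basis assms)
  then show ?thesis
    using assms finite_I by simp
qed

lemma coord_proj: "i \<in> I \<Longrightarrow> \<theta> i (proj I b \<theta> v) = \<theta> i v"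
  unfolding proj_def by (rule coord_combination)

lemma coord_proj_dual: "i \<in> I \<Longrightarrow> \<theta> i \<in> proj_dual I b \<theta>"
  by (simp add: proj_dual_def coord_dual coord_proj)

lemma proj_proj: "proj I b \<theta> (proj I b \<theta> v) = proj I b \<theta> v"
  unfolding proj_def[of I b \<theta> "proj I b \<theta> v"] by (simp add: coord_proj) (simp add: proj_def)

lemma proj_Endo: "proj I b \<theta> \<in> Endo act"
  by (simp add: Endo_def proj_def coord_dual dual_add dual_act act_add_right act_mult sum.distrib
      act_sum_left)

lemma subspace_range_proj: "V.subspace (range (proj I b \<theta>))"
proof (rule V.subspaceI)
  show "0 \<in> range (proj I b \<theta>)"
    by (metis Endo_zero proj_Endo rangeI)
  show "x + y \<in> range (proj I b \<theta>)" if "x \<in> range (proj I b \<theta>)" "y \<in> range (proj I b \<theta>)" for x y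
    using that by (auto simp flip: Endo_add[OF proj_Endo])
  show "scaleV emb act c x \<in> range (proj I b \<theta>)" if "x \<in> range (proj I b \<theta>)" for c x
    using that by (auto simp: scaleV_def simp flip: Endo_act[OF proj_Endo])
qed

lemma range_proj_spanned:
  "spanned_by_at_most (scaleV emb act) (range (proj I b \<theta>)) (card D * card I)"
proof -
  let ?C = "(\<lambda>(i, e). act (b i) e) ` (I \<times> D)"
  have "act (b i) a \<in> V.span ?C" if "i \<in> I" for i a
  proof -
    have "Vector_Spaces.linear (scaleD emb) (scaleV emb act) (act (b i))"
      by unfold_locales (simp_all add: act_add_right scaleD_def scaleV_def act_emb_mult)
    then interpret l: Vector_Spaces.linear "scaleD emb" "scaleV emb act" "act (b i)" .
    have "act (b i) a \<in> V.span (act (b i) ` D)"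
      using l.spans_image[of UNIV D] span_D by blast
    also have "\<dots> \<subseteq> V.span ?C"
      using that by (intro V.span_mono) auto
    finally show ?thesis .
  qed
  then have "range (proj I b \<theta>) \<subseteq> V.span ?C"
    unfolding proj_def by (auto intro!: V.span_sum)
  moreover have "card ?C \<le> card D * card I"
    using card_image_le[of "I \<times> D"] finite_I finite_D by (simp add: mult.commute)
  ultimately show ?thesis
    unfolding spanned_by_at_most_def using finite_I finite_D by (intro exI[of _ ?C]) auto
qed

text \<open>A functional \<open>\<phi>\<close> of the corner has the left coefficients
  \<open>\<phi> (b i)\<close> in the coordinates; expanding these over \<open>D\<close> gives the
  spanning set to which \<open>singular_family_kernel\<close> is applied.\<close>

lemma proj_dual_span:
  obtains E where "finite E" "card E \<le> card D * card I" "F.span E = proj_dual I b \<theta>"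
proof
  let ?E = "(\<lambda>(i, e) v. e * \<theta> i v) ` (I \<times> D)"
  show "finite ?E"
    using finite_I finite_D by simp
  show "card ?E \<le> card D * card I"
    using card_image_le[of "I \<times> D"] finite_I finite_D by (simp add: mult.commute)
  have sub: "F.subspace (proj_dual I b \<theta>)"
    by (rule F.subspaceI)
      (auto simp: proj_dual_def dual_def scaleF_def distrib_left distrib_right mult.assoc add_ac)
  have "?E \<subseteq> proj_dual I b \<theta>"
    by (auto simp: proj_dual_def dual_def dual_add[OF coord_dual] dual_act[OF coord_dual] coord_proj
        distrib_left mult.assoc)
  moreover have "\<phi> \<in> F.span ?E" if "\<phi> \<in> proj_dual I b \<theta>" for \<phi>
  proof -
    have "(\<lambda>v. a * \<theta> i v) \<in> F.span ?E" if "i \<in> I" for i a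
    proof -
      have lin: "Vector_Spaces.linear (scaleD emb) (scaleF emb) (\<lambda>a v. a * \<theta> i v)"
        by unfold_locales (simp_all add: scaleD_def scaleF_def fun_eq_iff distrib_right mult.assoc)
      interpret l: Vector_Spaces.linear "scaleD emb" "scaleF emb" "\<lambda>a v. a * \<theta> i v"
        by (rule lin)
      have "(\<lambda>v. a * \<theta> i v) \<in> F.span ((\<lambda>a v. a * \<theta> i v) ` D)"
        using l.spans_image[of UNIV D] span_D by blast
      also have "\<dots> \<subseteq> F.span ?E"
        using that by (intro F.span_mono) auto
      finally show ?thesis .
    qed
    then have "(\<Sum>i\<in>I. (\<lambda>v. \<phi> (b i) * \<theta> i v)) \<in> F.span ?E"
      by (intro F.span_sum) auto
    moreover have "\<phi> = (\<Sum>i\<in>I. (\<lambda>v. \<phi> (b i) * \<theta> i v))"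
    proof
      fix v
      have phi: "\<phi> \<in> dual"
        using that by (simp add: proj_dual_def)
      have "\<phi> v = \<phi> (proj I b \<theta> v)"
        using that by (simp add: proj_dual_def)
      also have "\<dots> = (\<Sum>i\<in>I. \<phi> (b i) * \<theta> i v)"
        by (simp add: proj_def dual_sum[OF phi] dual_act[OF phi])
      finally show "\<phi> v = (\<Sum>i\<in>I. (\<lambda>v. \<phi> (b i) * \<theta> i v)) v"
        by (simp add: sum_apply)
    qed
    ultimately show ?thesis
      by simp
  qed
  ultimately show "F.span ?E = proj_dual I b \<theta>"
    using F.span_minimal[OF _ sub] by blast
qed

text \<open>Steinitz exchange of \<open>b k\<close> for \<open>x\<close>, after which
  \<open>x\<close> is discarded: the new coordinates vanish at \<open>x\<close>, so the smaller
  idempotent models the quotient by the line of \<open>x\<close>.\<close>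

lemma dual_system_exchange:
  assumes x: "proj I b \<theta> x = x" "x \<noteq> 0"
  obtains k \<theta>' \<eta> where "k \<in> I" "dual_system (I - {k}) b \<theta>'" "\<eta> \<in> proj_dual I b \<theta>" "\<eta> x = 1"
    "\<And>v. proj (I - {k}) b \<theta>' v = proj I b \<theta> v - act x (\<eta> v)"
proof -
  have "\<exists>k\<in>I. \<theta> k x \<noteq> 0"
  proof (rule ccontr)
    assume "\<not> (\<exists>k\<in>I. \<theta> k x \<noteq> 0)"
    then have "proj I b \<theta> x = 0"
      unfolding proj_def by (intro sum.neutral) simp
    then show False
      using x by simp
  qed
  then obtain k where k: "k \<in> I" "\<theta> k x \<noteq> 0"
    by blast
  \<comment> \<open>The \<open>k\<close>-th coordinate scaled to be 1 at \<open>x\<close>. It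
    vanishes on the other \<open>b j\<close>, so the correction in \<open>\<theta>'\<close>
    preserves duality.\<close>
  define \<eta> where "\<eta> v = inverse (\<theta> k x) * \<theta> k v" for v
  define \<theta>' where "\<theta>' i v = \<theta> i v - \<theta> i x * \<eta> v" for i v
  have eta_dual: "\<eta> \<in> dual"
    by (simp add: dual_def \<eta>_def dual_add[OF coord_dual[OF k(1)]] dual_act[OF coord_dual[OF k(1)]]
        distrib_left mult.assoc)
  have "dual_system (I - {k}) b \<theta>'"
    unfolding dual_system_def
  proof (intro conjI ballI)
    show "finite (I - {k})"
      using finite_I by simp
    show "\<theta>' i \<in> dual" if "i \<in> I - {k}" for i
      using that by (simp add: dual_def \<theta>'_def dual_add[OF coord_dual] dual_act[OF coord_dual]
          dual_add[OF eta_dual] dual_act[OF eta_dual] algebra_simps)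
    show "\<theta>' i (b j) = (if i = j then 1 else 0)" if "i \<in> I - {k}" "j \<in> I - {k}" for i j
      using that k(1) by (auto simp: \<theta>'_def \<eta>_def coord_basis)
  qed
  moreover have "\<eta> \<in> proj_dual I b \<theta>"
    using eta_dual k(1) by (simp add: proj_dual_def) (simp add: \<eta>_def coord_proj)
  moreover have "\<eta> x = 1"
    using k by (simp add: \<eta>_def)
  moreover have "proj (I - {k}) b \<theta>' v = proj I b \<theta> v - act x (\<eta> v)" for v
  proof -
    \<comment> \<open>This allows the sum to run over all of \<open>I\<close>.\<close>
    have "\<theta>' k v = 0"
      using k by (simp add: \<theta>'_def \<eta>_def mult.assoc[symmetric])
    then have "proj (I - {k}) b \<theta>' v = proj I b \<theta>' v"
      unfolding proj_def by (intro sum.mono_neutral_left) (use finite_I in auto)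
    also have "\<dots> = proj I b \<theta> v - act (proj I b \<theta> x) (\<eta> v)"
      by (simp add: proj_def \<theta>'_def act_diff_right sum_subtractf act_sum_left act_mult)
    finally show ?thesis
      using x by simp
  qed
  ultimately show ?thesis
    using that k(1) by blast
qed

end

section \<open>Existence of an adapted vector\<close>

lemma subspace_projection:
  assumes S: "E.subspace S"
  obtains p where "Vector_Spaces.linear (scaleE emb act) (scaleE emb act) p" "\<And>u. p u = 0 \<longleftrightarrow> u \<in> S"
proof -
  have "Vector_Spaces.linear (scaleE emb act) (scaleE emb act) (\<lambda>u. u)"
    by (rule E.linear_ident)
  \<comment> \<open>A left inverse of the identity on \<open>S\<close> is a linear projection onto
    \<open>S\<close>; its complement has kernel exactly \<open>S\<close> and stands in for the
    quotient by \<open>S\<close>.\<close>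
  from EE.linear_exists_left_inverse_on[OF this S] obtain g
    where g: "range g \<subseteq> S" "Vector_Spaces.linear (scaleE emb act) (scaleE emb act) g"
      "\<And>u. u \<in> S \<Longrightarrow> g u = u"
    by auto
  have "Vector_Spaces.linear (scaleE emb act) (scaleE emb act) (\<lambda>u. u - g u)"
    by (intro EE.linear_compose_sub E.linear_ident g(2))
  moreover have "u - g u = 0 \<longleftrightarrow> u \<in> S" for u
    using g(1,3) by (metis eq_iff_diff_eq_0 rangeI subsetD)
  ultimately show ?thesis
    using that by blast
qed

text \<open>The functional \<open>\<phi>\<close> annihilates the range of \<open>id - u\<close>, so
  a right inverse would force \<open>\<phi> = 0\<close>.\<close>

lemma rank_one_diff_not_unit:
  assumes "\<phi> \<in> dual" "\<phi> x = 0" "\<phi> y = 1"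
    and u: "u = rank_one act y \<phi> - rank_one act x \<psi>"
  shows "\<not> unit_in A (\<circ>) id (id - u)"
proof
  assume "unit_in A (\<circ>) id (id - u)"
  then obtain w where "(id - u) \<circ> w = id"
    unfolding unit_in_def by blast
  then have "v = (id - u) (w v)" for v
    by (metis comp_apply id_apply)
  moreover have "\<phi> ((id - u) v) = 0" for v
    by (simp add: u rank_one_def dual_diff dual_act assms)
  ultimately have "\<phi> v = 0" for v
    by metis
  then show False
    using assms(3) by simp
qed

lemma adapted_vector:
  fixes I :: "'i set"
  assumes sys: "dual_system I b \<theta>" and I: "I \<noteq> {}"
    and card: "infinite (UNIV :: 'f set) \<or> card D * card I \<le> CARD('f)"
    and S: "trivial_spectrum_subspace (scaleE emb act) A (\<circ>) id S"
  obtains x where "proj I b \<theta> x = x" "x \<noteq> 0"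
    "\<And>\<phi>. \<phi> \<in> proj_dual I b \<theta> \<Longrightarrow> \<phi> x = 0 \<Longrightarrow> rank_one act x \<phi> \<in> S \<Longrightarrow> \<phi> = 0"
proof (rule ccontr)
  let ?\<pi> = "proj I b \<theta>"
  assume "\<not> thesis"
  then have bad: "\<exists>\<phi>\<in>proj_dual I b \<theta>. \<phi> \<noteq> 0 \<and> \<phi> x = 0 \<and> rank_one act x \<phi> \<in> S"
    if "?\<pi> x = x" "x \<noteq> 0" for x
    using that \<open>\<And>x. \<lbrakk>?\<pi> x = x; x \<noteq> 0; \<And>\<phi>. \<lbrakk>\<phi> \<in> proj_dual I b \<theta>; \<phi> x = 0; rank_one act x \<phi> \<in> S\<rbrakk> \<Longrightarrow> \<phi> = 0\<rbrakk> \<Longrightarrow> thesis\<close>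
    by blast
  have subS: "E.subspace S"
    using S by (simp add: trivial_spectrum_subspace_def)
  obtain p where p: "Vector_Spaces.linear (scaleE emb act) (scaleE emb act) p"
    "\<And>u. p u = 0 \<longleftrightarrow> u \<in> S"
    using subspace_projection[OF subS] by blast
  interpret p: Vector_Spaces.linear "scaleE emb act" "scaleE emb act" p by (rule p(1))
  obtain E0 where E0: "finite E0" "card E0 \<le> card D * card I" "F.span E0 = proj_dual I b \<theta>"
    using proj_dual_span[OF sys] by blast
  \<comment> \<open>\<open>p\<close> acts as reduction modulo \<open>S\<close>. Inserting
    \<open>?\<pi> x\<close> extends the family to all \<open>x\<close>, including those outside the
    range of \<open>?\<pi>\<close>.\<close>
  define T where "T x \<phi> = (p (rank_one act (?\<pi> x) \<phi>), \<phi> x)" for x and \<phi> :: "'v \<Rightarrow> 'd"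
  have lin: "Vector_Spaces.linear (scaleF emb) ED.scale (T x)" for x
  proof unfold_locales
    show "T x (\<phi> + \<psi>) = T x \<phi> + T x \<psi>" for \<phi> \<psi>
    proof -
      have "rank_one act (?\<pi> x) (\<phi> + \<psi>) = rank_one act (?\<pi> x) \<phi> + rank_one act (?\<pi> x) \<psi>"
        by (simp add: rank_one_def fun_eq_iff act_add_right)
      then show ?thesis
        by (simp add: T_def p.add)
    qed
    show "T x (scaleF emb c \<phi>) = ED.scale c (T x \<phi>)" for c \<phi>
    proof -
      have "rank_one act (?\<pi> x) (scaleF emb c \<phi>) = scaleE emb act c (rank_one act (?\<pi> x) \<phi>)"
        by (simp add: rank_one_def fun_eq_iff scaleF_def scaleE_def act_emb_mult)
      then show ?thesis
        by (simp add: T_def p.scale ED.scale_prod scaleD_def scaleF_def)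
    qed
  qed
  have "T (x + act y (emb t)) \<phi> = T x \<phi> + ED.scale t (T y \<phi>)" if "\<phi> \<in> F.span E0" for x y t \<phi>
  proof -
    have phi: "\<phi> \<in> dual"
      using that E0(3) by (simp add: proj_dual_def)
    have "rank_one act (?\<pi> (x + act y (emb t))) \<phi> =
        rank_one act (?\<pi> x) \<phi> + scaleE emb act t (rank_one act (?\<pi> y) \<phi>)"
      by (simp add: rank_one_def fun_eq_iff Endo_add[OF proj_Endo[OF sys]]
          Endo_act[OF proj_Endo[OF sys]] act_add_left scaleE_def act_emb_mult flip: act_mult)
    then show ?thesis
      by (simp add: T_def p.add p.scale ED.scale_prod scaleD_def dual_add[OF phi] dual_act[OF phi]
          emb_central)
  qed
  then have pencil: "\<exists>z. \<forall>\<phi>\<in>F.span E0. T z \<phi> = T x \<phi> + ED.scale t (T y \<phi>)" for x y t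
    by blast
  have zero_iff: "T x \<phi> = 0 \<longleftrightarrow> rank_one act (?\<pi> x) \<phi> \<in> S \<and> \<phi> x = 0" for x \<phi>
    by (simp add: T_def p(2) zero_prod_def)
  have sing: "\<exists>\<phi>\<in>F.span E0. \<phi> \<noteq> 0 \<and> T x \<phi> = 0" for x
  proof (cases "?\<pi> x = 0")
    case True
    \<comment> \<open>If \<open>?\<pi> x = 0\<close>, both components of \<open>T x\<close> vanish
      on every coordinate functional.\<close>
    obtain i where i: "i \<in> I"
      using I by blast
    have "\<theta> i \<noteq> 0"
      using coord_basis[OF sys i i] by (metis zero_fun_apply zero_neq_one)
    moreover have "\<theta> i x = 0"
      using coord_proj[OF sys i, of x] True dual_zero[OF coord_dual[OF sys i]] by simp
    moreover have "rank_one act (?\<pi> x) (\<theta> i) = 0"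
      using True by (simp add: rank_one_def fun_eq_iff)
    ultimately show ?thesis
      using coord_proj_dual[OF sys i] E0(3) E.subspace_0[OF subS] unfolding zero_iff by metis
  next
    case False
    from bad[OF proj_proj[OF sys] this] obtain \<phi>
      where phi: "\<phi> \<in> proj_dual I b \<theta>" "\<phi> \<noteq> 0" "\<phi> (?\<pi> x) = 0" "rank_one act (?\<pi> x) \<phi> \<in> S"
      by blast
    then show ?thesis
      unfolding zero_iff E0(3) by (auto simp: proj_dual_def)
  qed
  have "infinite (UNIV :: 'f set) \<or> card E0 \<le> CARD('f)"
    using card E0(2) by linarith
  from FP.singular_family_kernel[OF lin E0(1) this pencil sing] obtain x \<phi>
    where phi: "\<phi> \<in> proj_dual I b \<theta>" "\<phi> \<noteq> 0" "T x \<phi> = 0"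
      and rel: "\<And>y. \<exists>\<psi>\<in>proj_dual I b \<theta>. T y \<phi> = T x \<psi>"
    unfolding E0(3) by blast
  have phi_dual: "\<phi> \<in> dual"
    using phi by (simp add: proj_dual_def)
  obtain v where v: "\<phi> v \<noteq> 0"
    using phi(2) by (auto simp: fun_eq_iff)
  define y where "y = act v (inverse (\<phi> v))"
  have y: "\<phi> y = 1"
    using v by (simp add: y_def dual_act[OF phi_dual])
  obtain \<psi> where "T y \<phi> = T x \<psi>"
    using rel by blast
  then have "p (rank_one act (?\<pi> y) \<phi> - rank_one act (?\<pi> x) \<psi>) = 0"
    by (simp add: T_def p.diff)
  then have "rank_one act (?\<pi> y) \<phi> - rank_one act (?\<pi> x) \<psi> \<in> S"
    by (simp add: p(2))
  \<comment> \<open>Composition with \<open>?\<pi>\<close> does not change \<open>\<phi>\<close>, so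
    its values at \<open>x\<close> and \<open>y\<close> carry over.\<close>
  moreover have "\<phi> (?\<pi> x) = 0" "\<phi> (?\<pi> y) = 1"
    using phi(1,3) y by (simp_all add: zero_iff proj_dual_def)
  ultimately show False
    using rank_one_diff_not_unit[OF phi_dual] S unfolding trivial_spectrum_subspace_def by blast
qed

section \<open>Induction for the upper bound\<close>

lemma card_D_pos: "card D > 0"
  using finite_D one_D card_gt_0_iff by blast

text \<open>The induction step in numbers: \<open>d * Suc m - 1\<close> bounds the image of
  evaluation at the adapted vector, the other summand its kernel.\<close>

lemma alpha_Suc: "d > 0 \<Longrightarrow> alpha (Suc m) d = (d * Suc m - 1) + alpha m d"
  by (cases d) (simp_all add: alpha_def numeral_2_eq_2 algebra_simps)

text \<open>With \<open>e = rank_one act x \<eta>\<close> and \<open>u e = 0\<close>, one has \<open>1 - u + e u = (1 - u) (1 + e u)\<close>, and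
  \<open>e u\<close> has square zero.\<close>

lemma unit_deflate:
  assumes u: "u \<in> Endo act" "u x = 0" and eta: "\<eta> \<in> dual"
    and unit: "unit_in (Endo act) (\<circ>) id (id - u)"
  shows "unit_in (Endo act) (\<circ>) id (id - (\<lambda>v. u v - act x (\<eta> (u v))))"
proof -
  let ?f = "\<lambda>v. u v - act x (\<eta> (u v))"
  obtain w where w: "w \<in> Endo act" "(id - u) \<circ> w = id" "w \<circ> (id - u) = id"
    using unit unfolding unit_in_def by blast
  have w1: "w v - u (w v) = v" and w2: "w (v - u v) = v" for v
    using fun_cong[OF w(2), of v] fun_cong[OF w(3), of v] by simp_all
  have wx: "w x = x"
    using w2[of x] u(2) by simp
  \<comment> \<open>With \<open>e = rank_one act x \<eta>\<close>, this is
    \<open>(1 - e u) w\<close>, the inverse of \<open>(1 - u) (1 + e u)\<close>.\<close>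
  let ?w = "\<lambda>v. w v - act x (\<eta> (u (w v)))"
  note lin = Endo_add[OF u(1)] Endo_act[OF u(1)] Endo_add[OF w(1)] Endo_act[OF w(1)]
    Endo_diff[OF u(1)] Endo_diff[OF w(1)] dual_add[OF eta] dual_act[OF eta] dual_diff[OF eta]
    act_add_left act_add_right act_diff_left act_diff_right
  have "id - ?f \<in> Endo act" "?w \<in> Endo act"
    by (auto simp: Endo_def lin act_mult)
  moreover have "(id - ?f) \<circ> ?w = id"
    using w1 by (auto simp: fun_eq_iff lin u(2))
  moreover have "?w \<circ> (id - ?f) = id"
  proof
    fix v
    have "w (v - ?f v) = w (v - u v) + w (act x (\<eta> (u v)))"
      by (simp add: lin)
    also have "\<dots> = v + act x (\<eta> (u v))"
      by (simp add: w2 Endo_act[OF w(1)] wx)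
    finally show "(?w \<circ> (id - ?f)) v = id v"
      by (simp add: lin(1,2) u(2))
  qed
  ultimately show ?thesis
    unfolding unit_in_def by blast
qed

text \<open>Quotients of \<open>V\<close> are not types, so the induction runs over the corners \<open>\<pi> End(V) \<pi>\<close> of
  idempotents \<open>\<pi>\<close> given by dual systems.\<close>

lemma trivial_spectrum_bound:
  fixes I :: "'i set"
  assumes "dual_system I b \<theta>"
    and "infinite (UNIV :: 'f set) \<or> card D * card I \<le> CARD('f)"
    and "trivial_spectrum_subspace (scaleE emb act) (Endo act) (\<circ>) id S"
    and "\<And>u v. u \<in> S \<Longrightarrow> proj I b \<theta> (u v) = u v \<and> u (proj I b \<theta> v) = u v"
  shows "spanned_by_at_most (scaleE emb act) S (alpha (card I) (card D))"
  using assms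
proof (induction "card I" arbitrary: I \<theta> S)
  case 0
  then have "I = {}"
    by (simp add: dual_system_def)
  then have "S \<subseteq> {0}"
    using 0(5) by (fastforce simp: proj_def)
  then show ?case
    unfolding spanned_by_at_most_def by (intro exI[of _ "{}"]) auto
next
  case (Suc m)
  note sys = Suc(3) and card = Suc(4) and S = Suc(5) and corner = Suc(6)
  have finI: "finite I"
    by (rule finite_I[OF sys])
  let ?\<pi> = "proj I b \<theta>"
  have subS: "E.subspace S" and SE: "S \<subseteq> Endo act"
    and unit: "\<And>u. u \<in> S \<Longrightarrow> unit_in (Endo act) (\<circ>) id (id - u)"
    using S by (simp_all add: trivial_spectrum_subspace_def)
  have "I \<noteq> {}"
    using Suc(2) by auto
  then obtain x where x: "?\<pi> x = x" "x \<noteq> 0"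
    and adapted: "\<And>\<phi>. \<phi> \<in> proj_dual I b \<theta> \<Longrightarrow> \<phi> x = 0 \<Longrightarrow> rank_one act x \<phi> \<in> S \<Longrightarrow> \<phi> = 0"
    using adapted_vector[OF sys _ card S] by blast
  obtain k \<theta>' \<eta> where k: "k \<in> I" and sys': "dual_system (I - {k}) b \<theta>'"
    and eta: "\<eta> \<in> proj_dual I b \<theta>" "\<eta> x = 1"
    and proj': "\<And>v. proj (I - {k}) b \<theta>' v = ?\<pi> v - act x (\<eta> v)"
    using dual_system_exchange[OF sys x] by blast
  have eta_dual: "\<eta> \<in> dual"
    using eta by (simp add: proj_dual_def)
  have cardk: "m = card (I - {k})"
    using Suc(2) k finI by simp
  \<comment> \<open>Reduction of \<open>u\<close> along \<open>x\<close>. On \<open>S\<close> it is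
    composition with the smaller idempotent, and it takes \<open>S1\<close> into the smaller
    corner.\<close>
  define f where "f u = (\<lambda>v. u v - act x (\<eta> (u v)))" for u :: "'v \<Rightarrow> 'v"
  define S1 where "S1 = {u \<in> S. u x = 0}"
  have linf: "Vector_Spaces.linear (scaleE emb act) (scaleE emb act) f"
    by unfold_locales (auto simp: f_def scaleE_def fun_eq_iff dual_add[OF eta_dual]
        dual_act[OF eta_dual] act_add_right act_diff_left act_mult)
  interpret f: Vector_Spaces.linear "scaleE emb act" "scaleE emb act" f by (rule linf)
  have subS1: "E.subspace S1"
    using subS unfolding S1_def E.subspace_def by (auto simp: scaleE_def)
  have f_proj: "f u v = proj (I - {k}) b \<theta>' (u v)" if "u \<in> S" for u v
    using corner[OF that] by (simp add: f_def proj')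
  have "trivial_spectrum_subspace (scaleE emb act) (Endo act) (\<circ>) id (f ` S1)"
    unfolding trivial_spectrum_subspace_def
  proof (intro conjI ballI)
    show "f ` S1 \<subseteq> Endo act"
      using SE by (auto simp: S1_def f_def Endo_def dual_add[OF eta_dual] dual_act[OF eta_dual]
          act_add_right act_diff_left act_mult subset_iff)
    show "E.subspace (f ` S1)"
      by (rule f.subspace_image[OF subS1])
    show "unit_in (Endo act) (\<circ>) id (id - w)" if "w \<in> f ` S1" for w
      using that unit_deflate[OF _ _ eta_dual unit] SE by (auto simp: S1_def f_def)
  qed
  moreover have "proj (I - {k}) b \<theta>' (w v) = w v \<and> w (proj (I - {k}) b \<theta>' v) = w v"
    if "w \<in> f ` S1" for w v
  proof -
    obtain u where u: "u \<in> S" "u x = 0" "w = f u"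
      using \<open>w \<in> f ` S1\<close> unfolding S1_def by blast
    have uE: "u \<in> Endo act"
      using u SE by blast
    have "u (proj (I - {k}) b \<theta>' v) = u v"
      using corner[OF u(1)] by (simp add: proj' Endo_diff[OF uE] Endo_act[OF uE] u(2))
    then show ?thesis
      by (simp add: u(3) f_proj[OF u(1)] proj_proj[OF sys'])
  qed
  moreover have "infinite (UNIV :: 'f set) \<or> card D * card (I - {k}) \<le> CARD('f)"
    using card cardk Suc(2) by (metis le_SucI le_refl mult_le_mono2 order_trans)
  ultimately have "spanned_by_at_most (scaleE emb act) (f ` S1) (alpha m (card D))"
    using Suc(1)[OF cardk sys'] cardk by simp
  \<comment> \<open>An operator in \<open>S1\<close> killed by \<open>f\<close> has range in the
    line of \<open>x\<close>. Its functional \<open>\<lambda>v. \<eta> (u v)\<close> vanishes at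
    \<open>x\<close>, so adaptedness makes it zero.\<close>
  then have ker: "spanned_by_at_most (scaleE emb act) S1 (alpha m (card D))"
  proof (rule EE.injective_bound[OF linf subS1])
    fix u assume u: "u \<in> S1" "f u = 0"
    then have uS: "u \<in> S" "u x = 0" and uE: "u \<in> Endo act"
      using SE by (auto simp: S1_def)
    let ?\<phi> = "\<lambda>v. \<eta> (u v)"
    have eq: "u = rank_one act x ?\<phi>"
      using u(2) by (simp add: f_def rank_one_def fun_eq_iff)
    have "?\<phi> \<in> proj_dual I b \<theta>"
      using corner[OF uS(1)] by (simp add: proj_dual_def dual_def Endo_add[OF uE] Endo_act[OF uE]
          dual_add[OF eta_dual] dual_act[OF eta_dual])
    moreover have "?\<phi> x = 0"
      by (simp add: uS(2) dual_zero[OF eta_dual])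
    ultimately have "?\<phi> = 0"
      using adapted eq uS(1) by metis
    then show "u = 0"
      using eq by (simp add: rank_one_def fun_eq_iff)
  qed
  have linev: "Vector_Spaces.linear (scaleE emb act) (scaleV emb act) (\<lambda>u. u x)"
    by unfold_locales (auto simp: scaleE_def scaleV_def)
  interpret ev: Vector_Spaces.linear "scaleE emb act" "scaleV emb act" "\<lambda>u. u x" by (rule linev)
  \<comment> \<open>If \<open>u x = x\<close>, then \<open>id - u\<close> kills the nonzero vector
    \<open>x\<close>. So the image of evaluation at \<open>x\<close> is a proper subspace of the
    range of \<open>?\<pi>\<close>, which saves one dimension.\<close>
  have notin: "x \<notin> (\<lambda>u. u x) ` S"
  proof
    assume "x \<in> (\<lambda>u. u x) ` S"
    then obtain u where u: "u \<in> S" "u x = x"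
      by force
    obtain w where w: "w \<in> Endo act" "w \<circ> (id - u) = id"
      using unit[OF u(1)] unfolding unit_in_def by blast
    have "x = w (x - u x)"
      using fun_cong[OF w(2), of x] by simp
    then show False
      using u(2) x(2) Endo_zero[OF w(1)] by simp
  qed
  have sub: "(\<lambda>u. u x) ` S \<subseteq> range ?\<pi>"
  proof (rule image_subsetI)
    show "u x \<in> range ?\<pi>" if "u \<in> S" for u
      using corner[OF that, of x] by (intro range_eqI[of _ _ "u x"]) simp
  qed
  have mem: "x \<in> range ?\<pi>"
    using x(1) by (intro range_eqI[of _ _ x]) simp
  have "spanned_by_at_most (scaleV emb act) ((\<lambda>u. u x) ` S) (card D * card I - 1)"
    by (rule V.proper_subspace_spanned[OF range_proj_spanned[OF sys] subspace_range_proj[OF sys]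
        ev.subspace_image[OF subS] sub mem notin])
  from EV.rank_nullity_bound[OF linev subS this] ker
  show ?case
    unfolding S1_def using alpha_Suc[OF card_D_pos, of m] Suc(2) by simp
qed

end

subsection \<open>The lower bound\<close>

context division_algebra_space
begin

text \<open>Uniqueness of coordinates makes them linear. Numbering by \<open>{..<n}\<close> provides
  the order used for triangularity.\<close>

lemma dual_system_of_right_dimension:
  assumes "right_dimension act n"
  obtains b \<theta> where "dual_system {..<n} b \<theta>" "\<And>v. proj {..<n} b \<theta> v = v"
proof -
  obtain B where B: "right_basis act B" "card B = n"
    using assms unfolding right_dimension_def by blast
  then have fin: "finite B" and indep: "\<And>c. (\<Sum>b\<in>B. act b (c b)) = 0 \<Longrightarrow> \<forall>b\<in>B. c b = 0"
    and "\<forall>v. \<exists>c. v = (\<Sum>b\<in>B. act b (c b))"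
    unfolding right_basis_def by blast+
  then obtain C where C: "\<And>v. v = (\<Sum>b\<in>B. act b (C v b))"
    by metis
  have unique: "C v x = c x" if "v = (\<Sum>b\<in>B. act b (c b))" "x \<in> B" for v c x
  proof -
    have "(\<Sum>b\<in>B. act b (C v b - c b)) = v - v"
      by (simp only: act_diff_right sum_subtractf flip: C[of v] that(1))
    then show ?thesis
      using indep[of "\<lambda>b. C v b - c b"] that(2) by simp
  qed
  obtain h where h: "bij_betw h {..<n} B"
    using ex_bij_betw_nat_finite[OF fin] B(2) atLeast0LessThan by metis
  let ?\<theta> = "\<lambda>k v. C v (h k)"
  have hB: "h k \<in> B" if "k < n" for k
    using h that bij_betw_apply by fastforce
  have "dual_system {..<n} h ?\<theta>"
    unfolding dual_system_def dual_def
  proof (intro conjI ballI CollectI allI)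
    fix k assume k: "k \<in> {..<n}"
    show "C (v + w) (h k) = C v (h k) + C w (h k)" for v w
      using k hB C[of v] C[of w]
      by (intro unique) (simp_all add: act_add_right sum.distrib)
    show "C (act v a) (h k) = C v (h k) * a" for v a
    proof (rule unique)
      have "act v a = act (\<Sum>b\<in>B. act b (C v b)) a"
        using C[of v] by simp
      then show "act v a = (\<Sum>b\<in>B. act b (C v b * a))"
        by (simp add: act_sum_left act_mult)
    qed (use k hB in auto)
    show "C (h j) (h k) = (if k = j then 1 else 0)" if "j \<in> {..<n}" for j
    proof -
      have "(\<Sum>b\<in>B. act b (if b = h j then 1 else 0)) = (\<Sum>b\<in>B. if b = h j then b else 0)"
        by (rule sum.cong) (auto simp: act_one)
      then have "h j = (\<Sum>b\<in>B. act b (if b = h j then 1 else 0))"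
        using fin hB that by simp
      then have "C (h j) (h k) = (if h k = h j then 1 else 0)"
        using k hB by (intro unique) auto
      then show ?thesis
        using h k that by (auto simp: bij_betw_def inj_on_def)
    qed
  qed simp
  moreover have "proj {..<n} h ?\<theta> v = v" for v
    unfolding proj_def using sum.reindex_bij_betw[OF h, of "\<lambda>b. act b (C v b)"] C[of v] by simp
  ultimately show ?thesis
    using that by blast
qed

section \<open>The triangular space and its dimension\<close>

context
  fixes n :: nat and b \<theta>
  assumes sys: "dual_system {..<n} b \<theta>" and full: "\<And>v. proj {..<n} b \<theta> v = v"
begin

text \<open>Over the subfield \<open>V\<close> is finite-dimensional, so injective implies
  bijective; injectivity also transfers linearity over the division ring to the inverse.\<close>

lemma injective_Endo_unit:
  assumes u: "u \<in> Endo act" and inj: "\<And>v. u v = 0 \<Longrightarrow> v = 0"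
  shows "unit_in (Endo act) (\<circ>) id u"
proof -
  obtain C where C: "finite C" "(UNIV :: 'v set) \<subseteq> V.span C"
    using range_proj_spanned[OF sys] full unfolding spanned_by_at_most_def
    by (metis UNIV_eq_I rangeI)
  obtain B where B: "V.independent B" "V.span B = UNIV"
    using V.maximal_independent_subset[of UNIV] by (metis top.extremum_uniqueI)
  have "finite B"
    using V.independent_span_bound[OF C(1) B(1)] C(2) by auto
  then interpret fd: finite_dimensional_vector_space "scaleV emb act" B
    using B by unfold_locales auto
  have "Vector_Spaces.linear (scaleV emb act) (scaleV emb act) u"
    by unfold_locales (simp_all add: scaleV_def Endo_add[OF u] Endo_act[OF u])
  moreover have inj': "inj u"
    using inj by (intro injI) (metis Endo_diff[OF u] eq_iff_diff_eq_0)
  ultimately have "surj u"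
    by (rule fd.linear_inj_imp_surj)
  then have r: "u (inv u v) = v" for v
    by (rule surj_f_inv_f)
  have "inv u \<in> Endo act"
    unfolding Endo_def
    by (intro CollectI conjI allI; rule injD[OF inj']; simp add: r Endo_add[OF u] Endo_act[OF u])
  moreover have "u \<circ> inv u = id" "inv u \<circ> u = id"
    using r inj' by (auto simp: fun_eq_iff)
  ultimately show ?thesis
    unfolding unit_in_def using u by blast
qed

text \<open>\<open>\<theta> i (u (b k))\<close> is the matrix entry in row \<open>i\<close> and
  column \<open>k\<close>.\<close>

definition triangular :: "('v \<Rightarrow> 'v) set" where
  "triangular = {u \<in> Endo act. \<forall>i<n. \<forall>k<n. (k < i \<longrightarrow> \<theta> i (u (b k)) = 0) \<and>
     (i = k \<longrightarrow> \<theta> i (u (b k)) \<in> D.span (D - {1}))}"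

lemma subspace_triangular: "E.subspace triangular"
proof (rule E.subspaceI)
  have d: "\<theta> i \<in> dual" if "i < n" for i
    using coord_dual[OF sys] that by simp
  show "0 \<in> triangular"
    by (simp add: triangular_def Endo_def dual_zero[OF d] D.span_zero)
  show "u + w \<in> triangular" if "u \<in> triangular" "w \<in> triangular" for u w
    using that by (auto simp: triangular_def Endo_def dual_add[OF d] D.span_add act_add_left add_ac)
  show "scaleE emb act c u \<in> triangular" if "u \<in> triangular" for c u
  proof -
    have "\<theta> i (scaleE emb act c u v) = scaleD emb c (\<theta> i (u v))" if "i < n" for i v
      by (simp add: scaleE_def scaleD_def dual_act[OF d[OF that]] emb_central)
    moreover have "scaleE emb act c u \<in> Endo act"
      using that by (auto simp: triangular_def Endo_def scaleE_def act_add_left emb_central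
          simp flip: act_mult)
    ultimately show ?thesis
      using that by (auto simp: triangular_def D.span_scale)
  qed
qed

text \<open>At the last nonzero coordinate of a vector fixed by \<open>u\<close>, the diagonal entry
  would have to be 1, which the hyperplane excludes.\<close>

lemma triangular_unit:
  assumes u: "u \<in> triangular"
  shows "unit_in (Endo act) (\<circ>) id (id - u)"
proof (rule injective_Endo_unit)
  have uE: "u \<in> Endo act"
    using u by (simp add: triangular_def)
  show "id - u \<in> Endo act"
    using uE by (simp add: Endo_def act_diff_left)
  fix v assume "(id - u) v = 0"
  then have uv: "u v = v"
    by simp
  show "v = 0"
  proof (rule ccontr)
    assume "v \<noteq> 0"
    define K where "K = {k. k < n \<and> \<theta> k v \<noteq> 0}"
    have "K \<noteq> {}"
    proof
      assume "K = {}"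
      then have "proj {..<n} b \<theta> v = 0"
        unfolding proj_def K_def by (intro sum.neutral) auto
      then show False
        using full \<open>v \<noteq> 0\<close> by simp
    qed
    moreover have finK: "finite K"
      unfolding K_def by simp
    ultimately have "Max K \<in> K"
      by (rule Max_in[rotated])
    then obtain i where i: "i = Max K" "i < n" "\<theta> i v \<noteq> 0"
      unfolding K_def by blast
    have above: "\<theta> k v = 0" if "k < n" "i < k" for k
    proof -
      have "k \<notin> K"
        using Max_ge[OF finK] that i(1) by (metis not_le)
      then show ?thesis
        using that(1) by (simp add: K_def)
    qed
    have di: "\<theta> i \<in> dual"
      using coord_dual[OF sys] i(2) by simp
    have "\<theta> i v = \<theta> i (u (proj {..<n} b \<theta> v))"
      by (simp add: full uv)
    also have "\<dots> = (\<Sum>k<n. \<theta> i (u (b k)) * \<theta> k v)"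
      by (simp add: proj_def Endo_sum[OF uE] Endo_act[OF uE] dual_sum[OF di] dual_act[OF di])
    \<comment> \<open>Terms with \<open>k < i\<close> vanish by triangularity, those with
      \<open>k > i\<close> by maximality of \<open>i\<close>.\<close>
    also have "\<dots> = (\<Sum>k<n. if k = i then \<theta> i (u (b i)) * \<theta> i v else 0)"
    proof (rule sum.cong)
      fix k assume "k \<in> {..<n}"
      then show "\<theta> i (u (b k)) * \<theta> k v = (if k = i then \<theta> i (u (b i)) * \<theta> i v else 0)"
        using above u i(2) by (cases k i rule: linorder_cases) (auto simp: triangular_def)
    qed simp
    also have "\<dots> = \<theta> i (u (b i)) * \<theta> i v"
      using i(2) by simp
    finally have "\<theta> i (u (b i)) = 1"
      using i(3) by (metis mult_1_left mult_right_cancel)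
    moreover have "\<theta> i (u (b i)) \<in> D.span (D - {1})"
      using u i(2) by (simp add: triangular_def)
    ultimately have "1 \<in> D.span (D - {1})"
      by simp
    then show False
      using independent_D one_D D.dependent_def by blast
  qed
qed

text \<open>Triples of column, row and basis element of the division ring; on the diagonal the
  element 1 is left out.\<close>

definition triangular_index :: "(nat \<times> nat \<times> 'd) set" where
  "triangular_index = (SIGMA k:{..<n}. {..<k} \<times> D \<union> {k} \<times> (D - {1}))"

definition triangular_unit_matrix :: "nat \<times> nat \<times> 'd \<Rightarrow> 'v \<Rightarrow> 'v" where
  "triangular_unit_matrix = (\<lambda>(k, i, e). rank_one act (b i) (\<lambda>v. e * \<theta> k v))"

lemma finite_triangular_index: "finite triangular_index"
  unfolding triangular_index_def using finite_D by auto

text \<open>Column \<open>k\<close> has \<open>k\<close> free entries and one restricted diagonal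
  entry, together \<open>card D * Suc k - 1\<close> dimensions, the increment of
  \<open>alpha\<close>.\<close>

lemma card_triangular_index: "card triangular_index = alpha n (card D)"
proof -
  have "card ({..<k} \<times> D \<union> {k} \<times> (D - {1})) = card D * Suc k - 1" for k
  proof -
    have "card ({..<k} \<times> D \<union> {k} \<times> (D - {1})) = card ({..<k} \<times> D) + card ({k} \<times> (D - {1}))"
      using finite_D by (intro card_Un_disjoint) auto
    also have "\<dots> = k * card D + (card D - 1)"
      using finite_D one_D by (simp add: card_cartesian_product)
    finally show ?thesis
      using card_D_pos by (simp add: algebra_simps)
  qed
  then have "card triangular_index = (\<Sum>k<n. card D * Suc k - 1)"
    unfolding triangular_index_def using finite_D by (subst card_SigmaI) auto
  also have "\<dots> = alpha n (card D)"
    by (induction n) (simp_all add: alpha_Suc[OF card_D_pos] del: mult_Suc_right, simp add: alpha_def)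
  finally show ?thesis .
qed

lemma triangular_unit_matrix_coord:
  assumes "i < n" "k < n" "k' < n" "i' < n"
  shows "\<theta> i (triangular_unit_matrix (k', i', e) (b k)) = (if k' = k \<and> i' = i then e else 0)"
  using assms coord_dual[OF sys, of i] coord_basis[OF sys, of i i'] coord_basis[OF sys, of k' k]
  by (simp add: triangular_unit_matrix_def rank_one_def dual_act)

lemma triangular_unit_matrix_mem:
  assumes "j \<in> triangular_index"
  shows "triangular_unit_matrix j \<in> triangular"
proof -
  obtain k' i' e where j: "j = (k', i', e)"
    by (cases j) auto
  have jn: "k' < n" "i' < n" and or: "i' < k' \<or> i' = k' \<and> e \<in> D - {1}"
    using assms unfolding j triangular_index_def by auto
  have "(\<lambda>v. e * \<theta> k' v) \<in> dual"
    using coord_dual[OF sys, of k'] jn by (simp add: dual_def distrib_left mult.assoc)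
  then have "triangular_unit_matrix j \<in> Endo act"
    unfolding j triangular_unit_matrix_def by (simp add: rank_one_Endo)
  then show ?thesis
    using or unfolding j by (auto simp: triangular_def triangular_unit_matrix_coord jn D.span_zero
        intro: D.span_base)
qed

text \<open>Reading a relation at row \<open>i\<close> and column \<open>k\<close> leaves a relation
  between distinct elements of \<open>D\<close>.\<close>

lemma triangular_unit_matrix_independent:
  "inj_on triangular_unit_matrix triangular_index \<and>
    E.independent (triangular_unit_matrix ` triangular_index)"
proof (rule E.independent_family[OF finite_triangular_index], rule ballI)
  fix c j0
  assume zero: "(\<Sum>j\<in>triangular_index. scaleE emb act (c j) (triangular_unit_matrix j)) = 0"
    and j0: "j0 \<in> triangular_index"
  obtain k i e0 where j: "j0 = (k, i, e0)"
    by (cases j0) auto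
  have kn: "k < n" "i < n"
    using j0 unfolding j triangular_index_def by auto
  have di: "\<theta> i \<in> dual"
    using coord_dual[OF sys] kn by simp
  let ?D = "{e. (k, i, e) \<in> triangular_index}"
  have D: "?D \<subseteq> D"
    unfolding triangular_index_def by auto
  have summand: "\<theta> i (scaleE emb act (c j) (triangular_unit_matrix j) (b k)) =
      (if j \<in> Pair k ` Pair i ` ?D then scaleD emb (c j) (snd (snd j)) else 0)"
    if "j \<in> triangular_index" for j
  proof -
    obtain k' i' e where j': "j = (k', i', e)"
      by (cases j) auto
    have "k' < n" "i' < n"
      using that unfolding j' triangular_index_def by auto
    then show ?thesis
      using that kn unfolding j'
      by (auto simp: scaleE_def dual_act[OF di] triangular_unit_matrix_coord scaleD_def emb_central
          image_iff)
  qed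
  have "0 = \<theta> i ((\<Sum>j\<in>triangular_index. scaleE emb act (c j) (triangular_unit_matrix j)) (b k))"
    using dual_zero[OF di] by (simp add: zero)
  also have "\<dots> = (\<Sum>j\<in>triangular_index.
      if j \<in> Pair k ` Pair i ` ?D then scaleD emb (c j) (snd (snd j)) else 0)"
    unfolding sum_apply dual_sum[OF di] by (rule sum.cong) (simp_all add: summand)
  also have "\<dots> = (\<Sum>j\<in>Pair k ` Pair i ` ?D. scaleD emb (c j) (snd (snd j)))"
    by (rule sum.mono_neutral_cong_right) (auto simp: finite_triangular_index)
  also have "\<dots> = (\<Sum>e\<in>?D. scaleD emb (c (k, i, e)) e)"
    by (simp add: sum.reindex inj_on_def)
  finally have "(\<Sum>e\<in>?D. scaleD emb (c (k, i, e)) e) = 0"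
    by simp
  moreover have "finite ?D"
    using D finite_D finite_subset by blast
  ultimately show "c j0 = 0"
    using D.independentD[OF independent_D _ D, of "\<lambda>e. c (k, i, e)" e0] j0 j by simp
qed

lemma greatest_trivial_spectrum_dim_Endo:
  assumes "infinite (UNIV :: 'f set) \<or> card D * n \<le> CARD('f)"
  shows "greatest_trivial_spectrum_dim (scaleE emb act) (Endo act) (\<circ>) id (alpha n (card D))"
  unfolding greatest_trivial_spectrum_dim_def
proof (intro conjI allI impI)
  let ?S = "E.span (triangular_unit_matrix ` triangular_index)"
  have "?S \<subseteq> triangular"
    by (rule E.span_minimal[OF _ subspace_triangular]) (use triangular_unit_matrix_mem in auto)
  then have "trivial_spectrum_subspace (scaleE emb act) (Endo act) (\<circ>) id ?S"
    unfolding trivial_spectrum_subspace_def using triangular_unit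
    by (auto simp: triangular_def)
  moreover have "fin_dim (scaleE emb act) ?S (alpha n (card D))"
    using E.fin_dim_card[of "triangular_unit_matrix ` triangular_index"]
      triangular_unit_matrix_independent finite_triangular_index
    by (simp add: card_image card_triangular_index)
  ultimately show "\<exists>S. trivial_spectrum_subspace (scaleE emb act) (Endo act) (\<circ>) id S \<and>
      fin_dim (scaleE emb act) S (alpha n (card D))"
    by blast
next
  fix S assume S: "trivial_spectrum_subspace (scaleE emb act) (Endo act) (\<circ>) id S"
  have "spanned_by_at_most (scaleE emb act) S (alpha (card {..<n}) (card D))"
    \<comment> \<open>The idempotent is the identity, so its corner is the whole endomorphism
      algebra.\<close>
    using assms by (intro trivial_spectrum_bound[OF sys _ S]) (simp_all add: full)
  then show "\<exists>m\<le>alpha n (card D). fin_dim (scaleE emb act) S m"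
    using E.spanned_by_at_most_imp_fin_dim by simp
qed

end

end

subsection \<open>Matrices\<close>

context vector_space_pair
begin

text \<open>Units, subspaces and dimensions correspond under an algebra isomorphism onto
  \<open>A\<close>, so both the extremal example and the bound pull back.\<close>

lemma greatest_trivial_spectrum_dim_transfer:
  assumes lin: "Vector_Spaces.linear s1 s2 \<Phi>" and inj: "inj \<Phi>" and range: "range \<Phi> = A"
    and mul: "\<And>x y. \<Phi> (mul x y) = mul' (\<Phi> x) (\<Phi> y)" and one: "\<Phi> e = e'"
    and greatest: "greatest_trivial_spectrum_dim s2 A mul' e' k"
  shows "greatest_trivial_spectrum_dim s1 UNIV mul e k"
proof -
  interpret f: Vector_Spaces.linear s1 s2 \<Phi> by fact
  have "unit_in UNIV mul e x \<longleftrightarrow> unit_in A mul' e' (\<Phi> x)" for x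
  proof -
    have "unit_in A mul' e' (\<Phi> x) \<longleftrightarrow> (\<exists>y. \<Phi> (mul x y) = \<Phi> e \<and> \<Phi> (mul y x) = \<Phi> e)"
      unfolding unit_in_def mul one range[symmetric] by blast
    then show ?thesis
      unfolding unit_in_def inj_eq[OF inj] by blast
  qed
  moreover have "vs1.subspace S \<longleftrightarrow> vs2.subspace (\<Phi> ` S)" for S
    using f.subspace_image[of S] f.subspace_vimage[of "\<Phi> ` S"] inj_vimage_image_eq[OF inj, of S]
    by auto
  ultimately have tss: "trivial_spectrum_subspace s1 UNIV mul e S \<longleftrightarrow>
      trivial_spectrum_subspace s2 A mul' e' (\<Phi> ` S)" for S
    unfolding trivial_spectrum_subspace_def using range by (auto simp: f.diff one)
  show ?thesis
    unfolding greatest_trivial_spectrum_dim_def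
  proof (intro conjI allI impI)
    obtain S' where S': "trivial_spectrum_subspace s2 A mul' e' S'" "fin_dim s2 S' k"
      using greatest unfolding greatest_trivial_spectrum_dim_def by blast
    then have "S' = \<Phi> ` (\<Phi> -` S')"
      using range unfolding trivial_spectrum_subspace_def by auto
    then show "\<exists>S. trivial_spectrum_subspace s1 UNIV mul e S \<and> fin_dim s1 S k"
      using S' tss fin_dim_injective_image[OF lin inj] by metis
    show "\<exists>m\<le>k. fin_dim s1 S m" if "trivial_spectrum_subspace s1 UNIV mul e S" for S
    proof -
      have "\<exists>m\<le>k. fin_dim s2 (\<Phi> ` S) m"
        using that greatest unfolding greatest_trivial_spectrum_dim_def tss by simp
      then show ?thesis
        by (simp only: fin_dim_injective_image[OF lin inj])
    qed
  qed
qed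

end

text \<open>Scalars multiply columns on the right, so that left multiplication by matrices commutes
  with them.\<close>

definition vec_act :: "'d::division_ring ^ 'n \<Rightarrow> 'd \<Rightarrow> 'd ^ 'n" where
  "vec_act v a = (\<chi> i. v $ i * a)"

lemma right_vector_space_vec_act:
  "right_vector_space (vec_act :: 'd::division_ring ^ 'n::finite \<Rightarrow> 'd \<Rightarrow> 'd ^ 'n)"
  by unfold_locales (simp_all add: vec_act_def vec_eq_iff algebra_simps)

lemma matrix_vector_axis:
  fixes M :: "'d::division_ring ^ 'n::finite ^ 'm"
  shows "(M *v axis j 1) $ i = M $ i $ j"
  by (simp add: matrix_vector_mult_def axis_def if_distrib cong: if_cong)

lemma vec_expand: "v = (\<Sum>j\<in>UNIV. vec_act (axis j 1) (v $ j))" for v :: "'d::division_ring ^ 'n::finite"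
  by (simp add: vec_eq_iff vec_act_def axis_def if_distrib if_distribR cong: if_cong)

text \<open>The values of an endomorphism on the standard basis are the columns of its
  matrix.\<close>

lemma Endo_vec_act:
  "range (\<lambda>M v. M *v v) = Endo (vec_act :: 'd::division_ring ^ 'n::finite \<Rightarrow> 'd \<Rightarrow> 'd ^ 'n)"
proof
  show "range (\<lambda>M v. M *v v) \<subseteq> Endo (vec_act :: 'd ^ 'n \<Rightarrow> 'd \<Rightarrow> 'd ^ 'n)"
    by (auto simp: Endo_def vec_act_def vec_eq_iff matrix_vector_mult_def distrib_left sum.distrib
        sum_distrib_right mult.assoc)
next
  show "Endo (vec_act :: 'd ^ 'n \<Rightarrow> 'd \<Rightarrow> 'd ^ 'n) \<subseteq> range (\<lambda>M v. M *v v)"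
  proof
    fix u :: "'d ^ 'n \<Rightarrow> 'd ^ 'n" assume u: "u \<in> Endo vec_act"
    have "u 0 = 0"
      using u by (simp add: Endo_def) (metis add_cancel_right_right)
    then have sum: "u (sum f A) = (\<Sum>j\<in>A. u (f j))" for f :: "'n \<Rightarrow> 'd ^ 'n" and A
      using u by (induction A rule: infinite_finite_induct) (simp_all add: Endo_def)
    have eq: "u v = (\<chi> i j. u (axis j 1) $ i) *v v" for v
    proof -
      have "u v = (\<Sum>j\<in>UNIV. vec_act (u (axis j 1)) (v $ j))"
        using u by (subst vec_expand[of v]) (simp add: sum Endo_def)
      then show ?thesis
        by (simp add: vec_eq_iff matrix_vector_mult_def vec_act_def)
    qed
    show "u \<in> range (\<lambda>M v. M *v v)"
      by (rule range_eqI[of _ _ "\<chi> i j. u (axis j 1) $ i"], rule ext, rule eq)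
  qed
qed

text \<open>Matrices are scaled on the left, endomorphisms on the right; \<open>*v\<close> respects
  both because the subfield is central.\<close>

lemma matrix_algebra_iso:
  assumes "central_subfield emb"
    and "greatest_trivial_spectrum_dim (scaleE emb vec_act)
      (Endo (vec_act :: 'd::division_ring ^ 'n::finite \<Rightarrow> 'd \<Rightarrow> 'd ^ 'n)) (\<circ>) id k"
  shows "greatest_trivial_spectrum_dim (scaleM emb) (UNIV :: ('d^'n^'n) set) (**) (mat 1) k"
proof -
  interpret central_subfield emb by fact
  interpret vector_space_pair "scaleM emb :: _ \<Rightarrow> 'd^'n^'n \<Rightarrow> 'd^'n^'n"
    "scaleE emb (vec_act :: 'd ^ 'n \<Rightarrow> 'd \<Rightarrow> 'd ^ 'n)"
    by (intro vector_space_pair.intro vector_space_scaleM vector_space_scaleE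
        right_vector_space_vec_act assms(1))
  let ?\<Phi> = "\<lambda>(M :: 'd^'n^'n) v. M *v v"
  have "Vector_Spaces.linear (scaleM emb) (scaleE emb vec_act) ?\<Phi>"
  proof unfold_locales
    show "?\<Phi> (M + N) = ?\<Phi> M + ?\<Phi> N" for M N
      by (simp add: fun_eq_iff matrix_vector_mult_def vec_eq_iff distrib_right sum.distrib)
    show "?\<Phi> (scaleM emb c M) = scaleE emb vec_act c (?\<Phi> M)" for c M
      by (simp add: fun_eq_iff matrix_vector_mult_def vec_eq_iff scaleM_def scaleE_def vec_act_def
          mult.assoc flip: sum_distrib_left emb_central)
  qed
  moreover have "inj ?\<Phi>"
  proof (rule injI)
    show "M = N" if "?\<Phi> M = ?\<Phi> N" for M N
      using fun_cong[OF that] by (metis matrix_vector_axis vec_eq_iff)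
  qed
  moreover have "?\<Phi> (M ** N) = ?\<Phi> M \<circ> ?\<Phi> N" for M N
    by (simp add: fun_eq_iff matrix_vector_mul_assoc)
  moreover have "?\<Phi> (mat 1) = id"
    by (simp add: fun_eq_iff)
  ultimately show ?thesis
    using greatest_trivial_spectrum_dim_transfer[OF _ _ Endo_vec_act _ _ assms(2)] by blast
qed

theorem theorem1p8:
  fixes emb :: "'f::field \<Rightarrow> 'd::division_ring"
    and act :: "'v::ab_group_add \<Rightarrow> 'd \<Rightarrow> 'v"
    and d n :: nat
  assumes "central_subfield emb"
    and "fin_dim (scaleD emb) UNIV d"
    and "right_vector_space act"
    and "right_dimension act n"
    and "n > 0"
    and "infinite (UNIV :: 'f set) \<or> CARD('f) \<ge> d * n"
  shows "greatest_trivial_spectrum_dim (scaleE emb act) (Endo act) (\<circ>) id (alpha n d)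
    \<and> (CARD('n::finite) = n \<longrightarrow>
         greatest_trivial_spectrum_dim (scaleM emb) (UNIV :: ('d^'n^'n) set) (**) (mat 1) (alpha n d))"
proof -
  interpret central_subfield emb by fact
  interpret S: vector_space "scaleD emb" by (rule vector_space_scaleD)
  obtain C where C: "finite C" "UNIV \<subseteq> S.span C" and dim: "S.dim (UNIV :: 'd set) = d"
    using assms(2) unfolding fin_dim_def by blast
  \<comment> \<open>Starting the basis from 1 secures \<open>one_D\<close>, on which the hyperplane
    of the lower bound rests.\<close>
  have "S.independent {1}"
    by simp
  then obtain D where D: "{1} \<subseteq> D" "S.independent D" "UNIV \<subseteq> S.span D"
    using S.maximal_independent_subset_extend[of "{1}" UNIV] by auto
  have finD: "finite D"
    using S.independent_span_bound[OF C(1) D(2)] C(2) by auto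
  have d: "d = card D"
    using S.basis_card_eq_dim[OF _ D(3,2)] dim by simp
  \<comment> \<open>Stated for an arbitrary space, since it serves both \<open>act\<close> and the
    column vectors.\<close>
  have loc: "division_algebra_space emb act' D" if "right_vector_space act'"
    for act' :: "'w::ab_group_add \<Rightarrow> 'd \<Rightarrow> 'w"
    using that D finD by (intro division_algebra_space.intro division_algebra_space_axioms.intro assms(1)) auto
  interpret A: division_algebra_space emb act D
    by (rule loc) (rule assms(3))
  obtain b \<theta> where "A.dual_system {..<n} b \<theta>" "\<And>v. A.proj {..<n} b \<theta> v = v"
    using A.dual_system_of_right_dimension[OF assms(4)] by blast
  from A.greatest_trivial_spectrum_dim_Endo[OF this] assms(6)
  have "greatest_trivial_spectrum_dim (scaleE emb act) (Endo act) (\<circ>) id (alpha n d)"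
    unfolding d by blast
  moreover have "greatest_trivial_spectrum_dim (scaleM emb) (UNIV :: ('d^'n^'n) set) (**) (mat 1) (alpha n d)"
    if card: "CARD('n) = n"
  proof (rule matrix_algebra_iso[OF assms(1)])
    \<comment> \<open>Matrices are handled as endomorphisms of column space; the standard basis and
      its coordinates form the dual system.\<close>
    interpret M: division_algebra_space emb "vec_act :: 'd^'n \<Rightarrow> 'd \<Rightarrow> 'd^'n" D
      by (rule loc) (rule right_vector_space_vec_act)
    obtain h where h: "bij_betw h {..<n} (UNIV :: 'n set)"
      using ex_bij_betw_nat_finite[of "UNIV :: 'n set"] card atLeast0LessThan by auto
    let ?b = "\<lambda>k. axis (h k) 1" and ?\<theta> = "\<lambda>k v. v $ h k"
    have "M.dual_system {..<n} ?b ?\<theta>"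
      using h by (auto simp: M.dual_system_def M.dual_def vec_act_def axis_def bij_betw_def inj_on_def)
    moreover have "M.proj {..<n} ?b ?\<theta> v = v" for v
      unfolding M.proj_def
      using sum.reindex_bij_betw[OF h, of "\<lambda>i. vec_act (axis i 1) (v $ i)"] vec_expand[of v] by simp
    ultimately show "greatest_trivial_spectrum_dim (scaleE emb vec_act)
        (Endo (vec_act :: 'd^'n \<Rightarrow> 'd \<Rightarrow> 'd^'n)) (\<circ>) id (alpha n d)"
      using M.greatest_trivial_spectrum_dim_Endo assms(6) unfolding d by blast
  qed
  ultimately show ?thesis
    by blast
qed

end
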